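(* Let $G_1$ be the group generated by $f_1,\dots,f_6$ with multiplication of generators given by $$f_1^2=f_5,\quad f_2^2=f_6,\quad f_3^2=f_4^2=f_5^2=f_6^2=1,$$ $$f_2f_1=f_1f_2f_5,\quad f_3f_1=f_1f_3f_6,\quad f_4f_2=f_2f_4f_5,\quad f_3f_2=f_2f_3,\quad f_4f_1=f_1f_4,\quad f_4f_3=f_3f_4,$$ with $f_5$ and $f_6$ commuting with all generators. Let $G_2$ be the group generated by $f_1,\dots,f_6$ with multiplication of generators given by $$f_1^2=1,\quad f_2^2=f_6,\quad f_3^2=f_4^2=f_5,\quad f_5^2=f_6^2=1,$$ $$f_2f_1=f_1f_2f_5,\quad f_3f_1=f_1f_3f_6,\quad f_4f_2=f_2f_4f_5,\quad f_3f_2=f_2f_3,\quad f_4f_1=f_1f_4,\quad f_4f_3=f_3f_4,$$ with $f_5$ and $f_6$ commuting with all generators. Then $G_1$ and $G_2$ (groups of order $64$) are not isomorphic as groups, but they are monoidally equivalent. The order lists of both groups are $$\mathrm{List}(G_1)=\mathrm{List}(G_2)=\{1,19,44,0,0,0,0\}.$$ Furthermore, $G_1$ is isomorphic to the Izumi--Kosaki group $G_{\mathrm{IK}}$.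
   Context: For a finite group $G$, $\mathrm{Rep}(G)$ denotes the $C^*$-tensor category of finite dimensional unitary representations of $G$, whose morphisms are intertwiners. Two finite groups $G$ and $H$ are called monoidally equivalent (or isocategorical) if $\mathrm{Rep}(G)$ and $\mathrm{Rep}(H)$ are equivalent as $C^*$-tensor categories (unitarily monoidally equivalent; no compatibility with the symmetric braidings or with the fiber functors is required). The order list of a finite group $G$ is the ordered tuple $\mathrm{List}(G)=\{D^{(d_1)},\dots,D^{(d_m)}\}$, where $d_1<\dots<d_m$ are the divisors of $|G|$ and $D^{(d)}$ is the number of elements of $G$ of order exactly $d$. For $|G|=64$ the divisors are $1,2,4,8,16,32,64$. The groups $G_1,G_2$ are those presented by the listed generators and relations (a polycyclic presentation of a group of order $64$, every element being uniquely $f_1^{a_1}\cdots f_6^{a_6}$ with $a_i\in\{0,1\}$). The Izumi--Kosaki group is $G_{\mathrm{IK}}=(\mathbb{Z}/4)^2\rtimes H$, where $H=\{1,h_1,h_2,h_1h_2\}\subset \mathrm{SL}_2(\mathbb{Z}/4)$, $h_1=\begin{pmatrix}1&2\\0&1\end{pmatrix}$, $h_2=\begin{pmatrix}1&0\\2&1\end{pmatrix}$, acting on column vectors of $(\mathbb{Z}/4)^2$ by matrix multiplication. *)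

theory Defs
  imports
    "HOL-Algebra.Multiplicative_Group"
    "HOL-Library.Numeral_Type"
    "Jordan_Normal_Form.Schur_Decomposition"
begin

section \<open>Tensor categories with a *-structure\<close>

text \<open>
  The data of a (not necessarily strict) C*-tensor category. The C*-norms on the hom spaces are not
  recorded, since they are determined by the composition and the *-operation.
  A morphism need not determine its source and target. \<open>comp_mor C S T\<close> is S after T, and
  \<open>associator C X Y Z\<close> is a morphism from (X Y) Z to X (Y Z).
\<close>

record ('o, 'm) tensor_category =
  Objs :: "'o set"
  Mors :: "'o \<Rightarrow> 'o \<Rightarrow> 'm set"
  id_mor :: "'o \<Rightarrow> 'm"
  comp_mor :: "'m \<Rightarrow> 'm \<Rightarrow> 'm"
  add_mor :: "'m \<Rightarrow> 'm \<Rightarrow> 'm"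
  scale_mor :: "complex \<Rightarrow> 'm \<Rightarrow> 'm"
  star_mor :: "'m \<Rightarrow> 'm"
  tensor_obj :: "'o \<Rightarrow> 'o \<Rightarrow> 'o"
  tensor_mor :: "'m \<Rightarrow> 'm \<Rightarrow> 'm"
  unit_obj :: "'o"
  associator :: "'o \<Rightarrow> 'o \<Rightarrow> 'o \<Rightarrow> 'm"
  left_unitor :: "'o \<Rightarrow> 'm"
  right_unitor :: "'o \<Rightarrow> 'm"

definition unitary_mors :: "('o, 'm) tensor_category \<Rightarrow> 'o \<Rightarrow> 'o \<Rightarrow> 'm set" where
  "unitary_mors C X Y = {u \<in> Mors C X Y.
     comp_mor C (star_mor C u) u = id_mor C X \<and> comp_mor C u (star_mor C u) = id_mor C Y}"

text \<open>
  The data of a tensor functor F from C to D. The morphism part takes the source and the target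
  as arguments; \<open>fun_unit F\<close> is the morphism from the unit of D to F(unit of C), and
  \<open>fun_tensor F X Y\<close> is the morphism from F(X) F(Y) to F(X Y).
\<close>

record ('o1, 'm1, 'o2, 'm2) tensor_functor =
  fun_obj :: "'o1 \<Rightarrow> 'o2"
  fun_mor :: "'o1 \<Rightarrow> 'o1 \<Rightarrow> 'm1 \<Rightarrow> 'm2"
  fun_unit :: "'m2"
  fun_tensor :: "'o1 \<Rightarrow> 'o1 \<Rightarrow> 'm2"

definition linear_star_functor ::
  "('o1, 'm1) tensor_category \<Rightarrow> ('o2, 'm2) tensor_category \<Rightarrow>
   ('o1, 'm1, 'o2, 'm2) tensor_functor \<Rightarrow> bool" where
  "linear_star_functor C D F \<longleftrightarrow>
     (\<forall>X\<in>Objs C. fun_obj F X \<in> Objs D) \<and>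
     (\<forall>X\<in>Objs C. \<forall>Y\<in>Objs C. \<forall>T\<in>Mors C X Y.
        fun_mor F X Y T \<in> Mors D (fun_obj F X) (fun_obj F Y)) \<and>
     (\<forall>X\<in>Objs C. fun_mor F X X (id_mor C X) = id_mor D (fun_obj F X)) \<and>
     (\<forall>X\<in>Objs C. \<forall>Y\<in>Objs C. \<forall>Z\<in>Objs C. \<forall>T\<in>Mors C X Y. \<forall>S\<in>Mors C Y Z.
        fun_mor F X Z (comp_mor C S T) = comp_mor D (fun_mor F Y Z S) (fun_mor F X Y T)) \<and>
     (\<forall>X\<in>Objs C. \<forall>Y\<in>Objs C. \<forall>S\<in>Mors C X Y. \<forall>T\<in>Mors C X Y.
        fun_mor F X Y (add_mor C S T) = add_mor D (fun_mor F X Y S) (fun_mor F X Y T)) \<and>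
     (\<forall>X\<in>Objs C. \<forall>Y\<in>Objs C. \<forall>c. \<forall>T\<in>Mors C X Y.
        fun_mor F X Y (scale_mor C c T) = scale_mor D c (fun_mor F X Y T)) \<and>
     (\<forall>X\<in>Objs C. \<forall>Y\<in>Objs C. \<forall>T\<in>Mors C X Y.
        fun_mor F Y X (star_mor C T) = star_mor D (fun_mor F X Y T))"

definition unitary_tensor_functor ::
  "('o1, 'm1) tensor_category \<Rightarrow> ('o2, 'm2) tensor_category \<Rightarrow>
   ('o1, 'm1, 'o2, 'm2) tensor_functor \<Rightarrow> bool" where
  "unitary_tensor_functor C D F \<longleftrightarrow>
     linear_star_functor C D F \<and>
     fun_unit F \<in> unitary_mors D (unit_obj D) (fun_obj F (unit_obj C)) \<and>
     (\<forall>X\<in>Objs C. \<forall>Y\<in>Objs C.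
        fun_tensor F X Y \<in> unitary_mors D (tensor_obj D (fun_obj F X) (fun_obj F Y))
                                          (fun_obj F (tensor_obj C X Y))) \<and>
     (\<forall>X\<in>Objs C. \<forall>Y\<in>Objs C. \<forall>X'\<in>Objs C. \<forall>Y'\<in>Objs C. \<forall>S\<in>Mors C X X'. \<forall>T\<in>Mors C Y Y'.
        comp_mor D (fun_mor F (tensor_obj C X Y) (tensor_obj C X' Y') (tensor_mor C S T))
                   (fun_tensor F X Y) =
        comp_mor D (fun_tensor F X' Y') (tensor_mor D (fun_mor F X X' S) (fun_mor F Y Y' T))) \<and>
     (\<forall>X\<in>Objs C. \<forall>Y\<in>Objs C. \<forall>Z\<in>Objs C.
        comp_mor D
          (fun_mor F (tensor_obj C (tensor_obj C X Y) Z) (tensor_obj C X (tensor_obj C Y Z))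
             (associator C X Y Z))
          (comp_mor D (fun_tensor F (tensor_obj C X Y) Z)
             (tensor_mor D (fun_tensor F X Y) (id_mor D (fun_obj F Z)))) =
        comp_mor D (fun_tensor F X (tensor_obj C Y Z))
          (comp_mor D (tensor_mor D (id_mor D (fun_obj F X)) (fun_tensor F Y Z))
             (associator D (fun_obj F X) (fun_obj F Y) (fun_obj F Z)))) \<and>
     (\<forall>X\<in>Objs C.
        comp_mor D (fun_mor F (tensor_obj C (unit_obj C) X) X (left_unitor C X))
          (comp_mor D (fun_tensor F (unit_obj C) X)
             (tensor_mor D (fun_unit F) (id_mor D (fun_obj F X)))) =
        left_unitor D (fun_obj F X)) \<and>
     (\<forall>X\<in>Objs C.
        comp_mor D (fun_mor F (tensor_obj C X (unit_obj C)) X (right_unitor C X))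
          (comp_mor D (fun_tensor F X (unit_obj C))
             (tensor_mor D (id_mor D (fun_obj F X)) (fun_unit F))) =
        right_unitor D (fun_obj F X))"

definition id_tensor_functor ::
  "('o, 'm) tensor_category \<Rightarrow> ('o, 'm, 'o, 'm) tensor_functor" where
  "id_tensor_functor C =
     \<lparr>fun_obj = (\<lambda>X. X),
      fun_mor = (\<lambda>X Y T. T),
      fun_unit = id_mor C (unit_obj C),
      fun_tensor = (\<lambda>X Y. id_mor C (tensor_obj C X Y))\<rparr>"

definition comp_tensor_functor ::
  "('o1, 'm1) tensor_category \<Rightarrow> ('o2, 'm2) tensor_category \<Rightarrow> ('o3, 'm3) tensor_category \<Rightarrow>
   ('o2, 'm2, 'o3, 'm3) tensor_functor \<Rightarrow> ('o1, 'm1, 'o2, 'm2) tensor_functor \<Rightarrow>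
   ('o1, 'm1, 'o3, 'm3) tensor_functor" where
  "comp_tensor_functor C D E G F =
     \<lparr>fun_obj = (\<lambda>X. fun_obj G (fun_obj F X)),
      fun_mor = (\<lambda>X Y T. fun_mor G (fun_obj F X) (fun_obj F Y) (fun_mor F X Y T)),
      fun_unit =
        comp_mor E (fun_mor G (unit_obj D) (fun_obj F (unit_obj C)) (fun_unit F)) (fun_unit G),
      fun_tensor = (\<lambda>X Y.
        comp_mor E
          (fun_mor G (tensor_obj D (fun_obj F X) (fun_obj F Y)) (fun_obj F (tensor_obj C X Y))
             (fun_tensor F X Y))
          (fun_tensor G (fun_obj F X) (fun_obj F Y)))\<rparr>"

definition unitary_monoidal_nat_iso ::
  "('o1, 'm1) tensor_category \<Rightarrow> ('o2, 'm2) tensor_category \<Rightarrow>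
   ('o1, 'm1, 'o2, 'm2) tensor_functor \<Rightarrow> ('o1, 'm1, 'o2, 'm2) tensor_functor \<Rightarrow>
   ('o1 \<Rightarrow> 'm2) \<Rightarrow> bool" where
  "unitary_monoidal_nat_iso C D F G \<eta> \<longleftrightarrow>
     (\<forall>X\<in>Objs C. \<eta> X \<in> unitary_mors D (fun_obj F X) (fun_obj G X)) \<and>
     (\<forall>X\<in>Objs C. \<forall>Y\<in>Objs C. \<forall>T\<in>Mors C X Y.
        comp_mor D (fun_mor G X Y T) (\<eta> X) = comp_mor D (\<eta> Y) (fun_mor F X Y T)) \<and>
     comp_mor D (\<eta> (unit_obj C)) (fun_unit F) = fun_unit G \<and>
     (\<forall>X\<in>Objs C. \<forall>Y\<in>Objs C.
        comp_mor D (\<eta> (tensor_obj C X Y)) (fun_tensor F X Y) =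
        comp_mor D (fun_tensor G X Y) (tensor_mor D (\<eta> X) (\<eta> Y)))"

definition unitarily_monoidally_equivalent ::
  "('o1, 'm1) tensor_category \<Rightarrow> ('o2, 'm2) tensor_category \<Rightarrow> bool" where
  "unitarily_monoidally_equivalent C D \<longleftrightarrow>
     (\<exists>F G \<eta> \<theta>. unitary_tensor_functor C D F \<and> unitary_tensor_functor D C G \<and>
        unitary_monoidal_nat_iso C C (comp_tensor_functor C D C G F) (id_tensor_functor C) \<eta> \<and>
        unitary_monoidal_nat_iso D D (comp_tensor_functor D C D F G) (id_tensor_functor D) \<theta>)"


section \<open>The category of finite dimensional unitary representations\<close>

definition unitary_group :: "nat \<Rightarrow> complex mat monoid" where
  "unitary_group n =
     \<lparr>carrier = {U \<in> carrier_mat n n. mat_adjoint U * U = 1\<^sub>m n \<and> U * mat_adjoint U = 1\<^sub>m n},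
      monoid.mult = (*), one = 1\<^sub>m n\<rparr>"

definition kronecker :: "complex mat \<Rightarrow> complex mat \<Rightarrow> complex mat" where
  "kronecker A B = mat (dim_row A * dim_row B) (dim_col A * dim_col B)
     (\<lambda>(i, j). A $$ (i div dim_row B, j div dim_col B) * B $$ (i mod dim_row B, j mod dim_col B))"

text \<open>
  Every finite dimensional Hilbert space is taken to be some \<open>\<complex>\<^sup>n\<close>, with n = 0 allowed, so that a
  representation is a pair (n, \<open>\<pi>\<close>) with \<open>\<pi>\<close> a homomorphism from G to U(n). The tensor product of
  \<open>\<complex>\<^sup>m\<close> and \<open>\<complex>\<^sup>n\<close> is identified with \<open>\<complex>\<^bsup>mn\<^esup>\<close> by ordering the product basis lexicographically;
  under this identification the associators and unitors are identity matrices.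
\<close>

definition Rep :: "('a, 'b) monoid_scheme \<Rightarrow> (nat \<times> ('a \<Rightarrow> complex mat), complex mat) tensor_category"
  where
  "Rep G =
     \<lparr>Objs = {(n, \<pi>). \<pi> \<in> hom G (unitary_group n) \<inter> extensional (carrier G)},
      Mors = (\<lambda>(m, \<pi>) (n, \<rho>). {T \<in> carrier_mat n m. \<forall>g\<in>carrier G. T * \<pi> g = \<rho> g * T}),
      id_mor = (\<lambda>(n, \<pi>). 1\<^sub>m n),
      comp_mor = (*),
      add_mor = (+),
      scale_mor = (\<cdot>\<^sub>m),
      star_mor = mat_adjoint,
      tensor_obj = (\<lambda>(m, \<pi>) (n, \<rho>). (m * n, \<lambda>g\<in>carrier G. kronecker (\<pi> g) (\<rho> g))),
      tensor_mor = kronecker,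
      unit_obj = (1, \<lambda>g\<in>carrier G. 1\<^sub>m 1),
      associator = (\<lambda>(l, \<pi>) (m, \<rho>) (n, \<sigma>). 1\<^sub>m (l * m * n)),
      left_unitor = (\<lambda>(n, \<pi>). 1\<^sub>m n),
      right_unitor = (\<lambda>(n, \<pi>). 1\<^sub>m n)\<rparr>"

definition monoidally_equivalent ::
  "('a, 'c) monoid_scheme \<Rightarrow> ('b, 'd) monoid_scheme \<Rightarrow> bool" where
  "monoidally_equivalent G H \<longleftrightarrow> unitarily_monoidally_equivalent (Rep G) (Rep H)"


section \<open>Order lists\<close>

definition order_list :: "('a, 'b) monoid_scheme \<Rightarrow> nat list" where
  "order_list G =
     map (\<lambda>d. card {x \<in> carrier G. group.ord G x = d}) (sorted_list_of_set {d. d dvd Coset.order G})"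


section \<open>Groups given by generators and relations\<close>

text \<open>
  The letter \<open>(x, True)\<close> stands for the generator x and \<open>(x, False)\<close> for its inverse. The generators
  are all elements of the type \<open>'g\<close>, and a relation l = r is a pair (l, r) of words.
\<close>

type_synonym 'g word = "('g \<times> bool) list"

inductive word_eq :: "('g word \<times> 'g word) set \<Rightarrow> 'g word \<Rightarrow> 'g word \<Rightarrow> bool"
  for R :: "('g word \<times> 'g word) set" where
  word_refl: "word_eq R u u"
| word_sym: "word_eq R u v \<Longrightarrow> word_eq R v u"
| word_trans: "word_eq R u v \<Longrightarrow> word_eq R v w \<Longrightarrow> word_eq R u w"
| word_cancel: "word_eq R (u @ [(x, b), (x, \<not> b)] @ v) (u @ v)"
| word_rel: "(l, r) \<in> R \<Longrightarrow> word_eq R (u @ l @ v) (u @ r @ v)"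

definition presented_group :: "('g word \<times> 'g word) set \<Rightarrow> 'g word set monoid" where
  "presented_group R =
     \<lparr>carrier = UNIV // {(u, v). word_eq R u v},
      monoid.mult = (\<lambda>A B. {w. \<exists>u\<in>A. \<exists>v\<in>B. word_eq R (u @ v) w}),
      one = {w. word_eq R [] w}\<rparr>"

datatype gen = F1 | F2 | F3 | F4 | F5 | F6

definition positive_relations :: "('g list \<times> 'g list) set \<Rightarrow> ('g word \<times> 'g word) set" where
  "positive_relations R =
     (\<lambda>(l, r). (map (\<lambda>x. (x, True)) l, map (\<lambda>x. (x, True)) r)) ` R"

definition commutation_relations :: "(gen list \<times> gen list) set" where
  "commutation_relations =
     {([F2, F1], [F1, F2, F5]), ([F3, F1], [F1, F3, F6]), ([F4, F2], [F2, F4, F5]),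
      ([F3, F2], [F2, F3]), ([F4, F1], [F1, F4]), ([F4, F3], [F3, F4])} \<union>
     {([F5, x], [x, F5]) | x. True} \<union> {([F6, x], [x, F6]) | x. True}"

definition G1 :: "gen word set monoid" where
  "G1 = presented_group (positive_relations
     ({([F1, F1], [F5]), ([F2, F2], [F6]), ([F3, F3], []), ([F4, F4], []),
       ([F5, F5], []), ([F6, F6], [])} \<union> commutation_relations))"

definition G2 :: "gen word set monoid" where
  "G2 = presented_group (positive_relations
     ({([F1, F1], []), ([F2, F2], [F6]), ([F3, F3], [F5]), ([F4, F4], [F5]),
       ([F5, F5], []), ([F6, F6], [])} \<union> commutation_relations))"


section \<open>The Izumi--Kosaki group\<close>

definition affine_semidirect :: "nat \<Rightarrow> 'a::comm_ring_1 mat set \<Rightarrow> ('a vec \<times> 'a mat) monoid" where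
  "affine_semidirect n H =
     \<lparr>carrier = carrier_vec n \<times> H,
      monoid.mult = (\<lambda>(v, A) (w, B). (v + A *\<^sub>v w, A * B)),
      one = (0\<^sub>v n, 1\<^sub>m n)\<rparr>"

text \<open>The type \<open>4\<close> is the ring of integers modulo 4.\<close>

definition ik_h1 :: "4 mat" where
  "ik_h1 = mat_of_rows_list 2 [[1, 2], [0, 1]]"

definition ik_h2 :: "4 mat" where
  "ik_h2 = mat_of_rows_list 2 [[1, 0], [2, 1]]"

definition G_IK :: "(4 vec \<times> 4 mat) monoid" where
  "G_IK = affine_semidirect 2 {1\<^sub>m 2, ik_h1, ik_h2, ik_h1 * ik_h2}"

end

theory Submission
  imports Defs "HOL-Library.Product_Plus"
begin

text \<open>
  The translation subgroup \<open>A = (Z/4)\<^sup>2\<close> of the Izumi--Kosaki group G is normal, and G acts on its dual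
  through \<open>SL\<^sub>2\<close>, hence fixes the class of the 2-cocycle \<open>\<beta>((j, k), (l, m)) = i\<^bsup>jm\<^esup>\<close>: for every g there is
  a function \<open>\<eta>\<^sub>g\<close> with \<open>\<beta>(g\<chi>, g\<psi>) \<eta>\<^sub>g(\<chi>) \<eta>\<^sub>g(\<psi>) = \<eta>\<^sub>g(\<chi> + \<psi>) \<beta>(\<chi>, \<psi>)\<close>. Given a unitary representation
  \<open>\<pi>\<close> of G, let M(f) be the functional calculus of its restriction to A. The unitaries \<open>\<pi>(g) M(\<eta>\<^sub>g)\<close> then
  represent a second group on the same set, in which the squares of \<open>h\<^sub>1\<close> and \<open>h\<^sub>2\<close> are \<open>(2, 0)\<close> and
  \<open>(0, 2)\<close>, and \<open>\<beta>\<close>, evaluated on the restriction of \<open>\<pi> \<otimes> \<rho>\<close> to \<open>A \<times> A\<close>, turns this assignment into a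
  unitary tensor functor, which the complex conjugate data invert. The two groups are \<open>G1\<close> and \<open>G2\<close>;
  only the first has a noncentral involution with a centralizer of index 2.
\<close>

subsection \<open>Kronecker products and linear combinations of matrices\<close>

text \<open>A circle-valued 2-cocycle on (Z/4)^2 is determined up to coboundaries by its commutator,
  the quotient of its values at (\<chi>, \<psi>) and (\<psi>, \<chi>). For \<beta> this is i^(jm -
  kl), a power of a determinant, which is why SL_2 fixes the class. The new squares come from the
  fact that the correcting functions are quadratic rather than linear. On the dual, h1 sends (j, k)
  to (j, k + 2j), which adds 2jl to the exponent jm; this is the polarization of j^2, so \<eta> at
  h1 is i^(j^2). Its square (-1)^j is evaluation of characters at (2, 0), so the new lift of h1
  squares to that translation. The roles of j and k are exchanged for h2. The notion of equivalence
  asks for two functors and two natural isomorphisms, not for a fully faithful and essentially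
  surjective functor. The construction therefore keeps all spaces, all intertwiners and the
  restriction to A unchanged: both functors then see the same spectral projections, and every
  operator identity becomes an identity between functions of modulus one on the dual or on a power
  of it.\<close>

lemma mat_adjoint_dim [simp]:
  "dim_row (mat_adjoint A) = dim_col A" "dim_col (mat_adjoint A) = dim_row A"
  by (simp_all add: mat_adjoint_def)

lemma mat_adjoint_carrier [simp, intro]:
  "A \<in> carrier_mat m n \<Longrightarrow> mat_adjoint A \<in> carrier_mat n m"
  by (intro carrier_matI) auto

lemma mat_adjoint_index [simp]:
  fixes A :: "complex mat"
  shows "i < dim_col A \<Longrightarrow> j < dim_row A \<Longrightarrow> mat_adjoint A $$ (i, j) = cnj (A $$ (j, i))"
  by (simp add: mat_adjoint_def mat_of_rows_index)

lemma mat_adjoint_mult: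
  fixes A B :: "complex mat"
  assumes "A \<in> carrier_mat l m" "B \<in> carrier_mat m n"
  shows "mat_adjoint (A * B) = mat_adjoint B * mat_adjoint A"
  using assms by (intro eq_matI) (auto simp: scalar_prod_def mult.commute)

lemma mat_adjoint_one [simp]: "mat_adjoint (1\<^sub>m n :: complex mat) = 1\<^sub>m n"
  by (intro eq_matI) auto

lemma kronecker_dim [simp]:
  "dim_row (kronecker A B) = dim_row A * dim_row B" "dim_col (kronecker A B) = dim_col A * dim_col B"
  by (simp_all add: kronecker_def)

lemma kronecker_carrier [simp, intro]:
  "A \<in> carrier_mat m n \<Longrightarrow> B \<in> carrier_mat p q \<Longrightarrow> kronecker A B \<in> carrier_mat (m * p) (n * q)"
  by (intro carrier_matI) auto

lemma kronecker_index [simp]: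
  "i < dim_row A * dim_row B \<Longrightarrow> j < dim_col A * dim_col B \<Longrightarrow>
   kronecker A B $$ (i, j) =
     A $$ (i div dim_row B, j div dim_col B) * B $$ (i mod dim_row B, j mod dim_col B)"
  by (simp add: kronecker_def)

lemma div_less_mult: "(i::nat) < m * p \<Longrightarrow> i div p < m"
  by (simp add: less_mult_imp_div_less)

lemma mod_less_mult: "(i::nat) < m * p \<Longrightarrow> i mod p < p"
  by (metis mod_less_divisor mult_0_right not_gr_zero not_less_zero)

text \<open>Lexicographic numbering of pairs: k corresponds to its quotient and remainder modulo p.
  This is the index arithmetic behind the mixed product rule for Kronecker products.\<close>

lemma sum_div_mod:
  fixes f :: "nat \<Rightarrow> nat \<Rightarrow> 'a::comm_monoid_add"
  shows "(\<Sum>k<m * p. f (k div p) (k mod p)) = (\<Sum>a<m. \<Sum>b<p. f a b)"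
proof -
  have "(\<Sum>a<m. \<Sum>b<p. f a b) = (\<Sum>(a, b)\<in>{..<m} \<times> {..<p}. f a b)"
    by (simp add: sum.cartesian_product)
  also have "\<dots> = (\<Sum>k<m * p. f (k div p) (k mod p))"
  proof (rule sum.reindex_bij_witness[where i = "\<lambda>k. (k div p, k mod p)" and j = "\<lambda>(a, b). a * p + b"])
    fix x assume "x \<in> {..<m} \<times> {..<p}"
    then obtain a b where x: "x = (a, b)" "a < m" "b < p" by auto
    have "a * p + b < Suc a * p" using x by simp
    also have "\<dots> \<le> m * p" using x by (intro mult_le_mono1) simp
    finally show "(case x of (a, b) \<Rightarrow> a * p + b) \<in> {..<m * p}" by (simp add: x)
  qed (auto simp: div_less_mult mod_less_mult)
  finally show ?thesis ..
qed

lemma kronecker_mult: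
  assumes A: "A \<in> carrier_mat l m" and B: "B \<in> carrier_mat m n"
    and C: "C \<in> carrier_mat p q" and D: "D \<in> carrier_mat q r"
  shows "kronecker (A * B) (C * D) = kronecker A C * kronecker B D"
proof (rule eq_matI)
  fix i j assume "i < dim_row (kronecker A C * kronecker B D)" "j < dim_col (kronecker A C * kronecker B D)"
  then have ij: "i < l * p" "j < n * r" using A B C D by auto
  let ?f = "\<lambda>a b. A $$ (i div p, a) * B $$ (a, j div r) * (C $$ (i mod p, b) * D $$ (b, j mod r))"
  have "kronecker (A * B) (C * D) $$ (i, j) =
      (\<Sum>a<m. A $$ (i div p, a) * B $$ (a, j div r)) * (\<Sum>b<q. C $$ (i mod p, b) * D $$ (b, j mod r))"
    using A B C D ij div_less_mult[OF ij(1)] div_less_mult[OF ij(2)] mod_less_mult[OF ij(1)] mod_less_mult[OF ij(2)]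
    by (simp add: scalar_prod_def lessThan_atLeast0)
  also have "\<dots> = (\<Sum>k<m * q. ?f (k div q) (k mod q))"
    by (simp add: sum_product sum_div_mod[where f = ?f])
  also have "\<dots> = (kronecker A C * kronecker B D) $$ (i, j)"
    using A B C D ij by (simp add: scalar_prod_def lessThan_atLeast0 mult.assoc mult.left_commute)
  finally show "kronecker (A * B) (C * D) $$ (i, j) = (kronecker A C * kronecker B D) $$ (i, j)" .
qed (use A B C D in auto)

lemma kronecker_one [simp]: "kronecker (1\<^sub>m m) (1\<^sub>m n) = 1\<^sub>m (m * n)"
proof (rule eq_matI)
  fix i j assume "i < dim_row (1\<^sub>m (m * n) :: complex mat)" "j < dim_col (1\<^sub>m (m * n) :: complex mat)"
  then have ij: "i < m * n" "j < m * n" by auto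
  have "i = j \<longleftrightarrow> i div n = j div n \<and> i mod n = j mod n"
    by (metis div_mult_mod_eq)
  with ij show "kronecker (1\<^sub>m m) (1\<^sub>m n) $$ (i, j) = (1\<^sub>m (m * n) :: complex mat) $$ (i, j)"
    by (auto simp: div_less_mult mod_less_mult)
qed auto

lemma kronecker_unit_left [simp]: "kronecker (1\<^sub>m (Suc 0)) A = A"
  by (rule eq_matI) (auto simp: div_less_mult mod_less_mult)

lemma kronecker_unit_right [simp]: "kronecker A (1\<^sub>m (Suc 0)) = A"
  by (rule eq_matI) auto

lemma kronecker_adjoint: "mat_adjoint (kronecker A B) = kronecker (mat_adjoint A) (mat_adjoint B)"
  by (rule eq_matI) (auto simp: div_less_mult mod_less_mult)

text \<open>An index below mnp has three digits in mixed radix, and splitting off the last one or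
  the first one leads to the same digits. Hence identity matrices can serve as associators.\<close>

lemma kronecker_assoc: "kronecker (kronecker A B) C = kronecker A (kronecker B C)"
proof (rule eq_matI)
  fix i j
  assume "i < dim_row (kronecker A (kronecker B C))" "j < dim_col (kronecker A (kronecker B C))"
  then have ij: "i < dim_row A * dim_row B * dim_row C" "j < dim_col A * dim_col B * dim_col C"
    by (auto simp: mult.assoc)
  have 1: "i div p < m * n" "i mod p < p" "i div (n * p) < m" "i mod (n * p) < n * p"
    "i div (n * p) = i div p div n" "i mod (n * p) div p = i div p mod n" "i mod (n * p) mod p = i mod p"
    if "i < m * n * p" for i m n p :: nat
  proof -
    show k: "i div p < m * n" "i mod p < p" using that by (auto simp: div_less_mult mod_less_mult)
    have "i < m * (n * p)" using that by (simp add: mult.assoc)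
    then show "i div (n * p) < m" "i mod (n * p) < n * p" by (auto simp: div_less_mult mod_less_mult)
    show "i div (n * p) = i div p div n" by (metis div_mult2_eq mult.commute)
    have m: "i mod (n * p) = p * (i div p mod n) + i mod p" by (metis mod_mult2_eq mult.commute)
    have "p > 0" using k(2) by simp
    then show "i mod (n * p) div p = i div p mod n" "i mod (n * p) mod p = i mod p" by (simp_all add: m)
  qed
  show "kronecker (kronecker A B) C $$ (i, j) = kronecker A (kronecker B C) $$ (i, j)"
    using ij 1[OF ij(1)] 1[OF ij(2)] by (simp add: mult.assoc)
qed (auto simp: mult.assoc)

text \<open>The dimensions are arguments so that an empty index set still yields a matrix of the
  right shape, and the sums are entrywise, hence ordinary complex sums.\<close>

definition lin_comb :: "nat \<Rightarrow> nat \<Rightarrow> 'i set \<Rightarrow> ('i \<Rightarrow> complex) \<Rightarrow> ('i \<Rightarrow> complex mat) \<Rightarrow> complex mat" where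
  "lin_comb m n S c f = mat m n (\<lambda>ij. \<Sum>s\<in>S. c s * f s $$ ij)"

lemma lin_comb_carrier [simp, intro]: "lin_comb m n S c f \<in> carrier_mat m n"
  by (simp add: lin_comb_def)

lemma lin_comb_dim [simp]: "dim_row (lin_comb m n S c f) = m" "dim_col (lin_comb m n S c f) = n"
  by (simp_all add: lin_comb_def)

lemma lin_comb_index [simp]:
  "i < m \<Longrightarrow> j < n \<Longrightarrow> lin_comb m n S c f $$ (i, j) = (\<Sum>s\<in>S. c s * f s $$ (i, j))"
  by (simp add: lin_comb_def)

lemma lin_comb_cong:
  "m = m' \<Longrightarrow> n = n' \<Longrightarrow> S = T \<Longrightarrow> (\<And>s. s \<in> T \<Longrightarrow> c s = d s) \<Longrightarrow> (\<And>s. s \<in> T \<Longrightarrow> f s = g s) \<Longrightarrow>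
   lin_comb m n S c f = lin_comb m' n' T d g"
  by (simp add: lin_comb_def)

lemma lin_comb_mult_left:
  assumes "B \<in> carrier_mat l m" "\<And>s. s \<in> S \<Longrightarrow> f s \<in> carrier_mat m n"
  shows "B * lin_comb m n S c f = lin_comb l n S c (\<lambda>s. B * f s)"
proof (rule eq_matI)
  fix i j assume "i < dim_row (lin_comb l n S c (\<lambda>s. B * f s))" "j < dim_col (lin_comb l n S c (\<lambda>s. B * f s))"
  then have ij: "i < l" "j < n" by auto
  have "(B * lin_comb m n S c f) $$ (i, j) = (\<Sum>k<m. \<Sum>s\<in>S. c s * (B $$ (i, k) * f s $$ (k, j)))"
    using assms ij by (simp add: scalar_prod_def lessThan_atLeast0 sum_distrib_left mult.left_commute)
  also have "\<dots> = (\<Sum>s\<in>S. c s * (B * f s) $$ (i, j))"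
    unfolding sum.swap[of _ S] sum_distrib_left[symmetric]
  proof (intro sum.cong refl arg_cong2[where f = "(*)"])
    fix s assume "s \<in> S"
    from assms(1) assms(2)[OF this] show "(\<Sum>k<m. B $$ (i, k) * f s $$ (k, j)) = (B * f s) $$ (i, j)"
      using ij by (auto simp: scalar_prod_def lessThan_atLeast0)
  qed
  finally show "(B * lin_comb m n S c f) $$ (i, j) = lin_comb l n S c (\<lambda>s. B * f s) $$ (i, j)"
    using ij by simp
qed (use assms in auto)

lemma lin_comb_mult_right:
  assumes "B \<in> carrier_mat n l" "\<And>s. s \<in> S \<Longrightarrow> f s \<in> carrier_mat m n"
  shows "lin_comb m n S c f * B = lin_comb m l S c (\<lambda>s. f s * B)"
proof (rule eq_matI)
  fix i j assume "i < dim_row (lin_comb m l S c (\<lambda>s. f s * B))" "j < dim_col (lin_comb m l S c (\<lambda>s. f s * B))"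
  then have ij: "i < m" "j < l" by auto
  have "(lin_comb m n S c f * B) $$ (i, j) = (\<Sum>k<n. \<Sum>s\<in>S. c s * (f s $$ (i, k) * B $$ (k, j)))"
    using assms ij by (simp add: scalar_prod_def lessThan_atLeast0 sum_distrib_right mult.assoc)
  also have "\<dots> = (\<Sum>s\<in>S. c s * (f s * B) $$ (i, j))"
    unfolding sum.swap[of _ S] sum_distrib_left[symmetric]
  proof (intro sum.cong refl arg_cong2[where f = "(*)"])
    fix s assume "s \<in> S"
    from assms(1) assms(2)[OF this] show "(\<Sum>k<n. f s $$ (i, k) * B $$ (k, j)) = (f s * B) $$ (i, j)"
      using ij by (auto simp: scalar_prod_def lessThan_atLeast0)
  qed
  finally show "(lin_comb m n S c f * B) $$ (i, j) = lin_comb m l S c (\<lambda>s. f s * B) $$ (i, j)"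
    using ij by simp
qed (use assms in auto)

lemma lin_comb_lin_comb:
  "lin_comb m n S c (\<lambda>s. lin_comb m n T (d s) f) = lin_comb m n T (\<lambda>t. \<Sum>s\<in>S. c s * d s t) f"
  by (rule eq_matI) (simp_all add: sum_distrib_left sum_distrib_right mult.assoc sum.swap[of _ T])

lemma lin_comb_smult:
  assumes "\<And>s. s \<in> S \<Longrightarrow> f s \<in> carrier_mat m n"
  shows "lin_comb m n S c (\<lambda>s. d s \<cdot>\<^sub>m f s) = lin_comb m n S (\<lambda>s. c s * d s) f"
proof (rule eq_matI)
  fix i j assume "i < dim_row (lin_comb m n S (\<lambda>s. c s * d s) f)" "j < dim_col (lin_comb m n S (\<lambda>s. c s * d s) f)"
  then have ij: "i < m" "j < n" by auto
  then have "(d s \<cdot>\<^sub>m f s) $$ (i, j) = d s * f s $$ (i, j)" if "s \<in> S" for s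
    using assms[OF that] by auto
  with ij show "lin_comb m n S c (\<lambda>s. d s \<cdot>\<^sub>m f s) $$ (i, j) = lin_comb m n S (\<lambda>s. c s * d s) f $$ (i, j)"
    by (simp add: mult.assoc)
qed auto

lemma smult_lin_comb: "a \<cdot>\<^sub>m lin_comb m n S c f = lin_comb m n S (\<lambda>s. a * c s) f"
  by (rule eq_matI) (simp_all add: sum_distrib_left mult.assoc)

lemma lin_comb_delta:
  assumes "finite S" "s \<in> S" "f s \<in> carrier_mat m n"
  shows "lin_comb m n S (\<lambda>t. of_bool (t = s)) f = f s"
proof (rule eq_matI)
  fix i j assume "i < dim_row (f s)" "j < dim_col (f s)"
  then show "lin_comb m n S (\<lambda>t. of_bool (t = s)) f $$ (i, j) = f s $$ (i, j)"
    using assms by (simp add: of_bool_def if_distrib[of "\<lambda>x. x * _"] sum.delta' cong: if_cong)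
qed (use assms in auto)

lemma lin_comb_adjoint:
  assumes "\<And>s. s \<in> S \<Longrightarrow> f s \<in> carrier_mat m n"
  shows "mat_adjoint (lin_comb m n S c f) = lin_comb n m S (\<lambda>s. cnj (c s)) (\<lambda>s. mat_adjoint (f s))"
proof (rule eq_matI)
  fix i j assume "i < dim_row (lin_comb n m S (\<lambda>s. cnj (c s)) (\<lambda>s. mat_adjoint (f s)))"
    "j < dim_col (lin_comb n m S (\<lambda>s. cnj (c s)) (\<lambda>s. mat_adjoint (f s)))"
  then have ij: "i < n" "j < m" by auto
  then have "mat_adjoint (f s) $$ (i, j) = cnj (f s $$ (j, i))" if "s \<in> S" for s
    using assms[OF that] by auto
  with ij show "mat_adjoint (lin_comb m n S c f) $$ (i, j) =
      lin_comb n m S (\<lambda>s. cnj (c s)) (\<lambda>s. mat_adjoint (f s)) $$ (i, j)"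
    by simp
qed auto

lemma kronecker_lin_comb:
  assumes "\<And>s. s \<in> S \<Longrightarrow> f s \<in> carrier_mat m n" "\<And>t. t \<in> T \<Longrightarrow> g t \<in> carrier_mat p q"
  shows "kronecker (lin_comb m n S c f) (lin_comb p q T d g) =
    lin_comb (m * p) (n * q) (S \<times> T) (\<lambda>(s, t). c s * d t) (\<lambda>(s, t). kronecker (f s) (g t))"
    (is "_ = ?R")
proof (rule eq_matI)
  fix i j assume "i < dim_row ?R" "j < dim_col ?R"
  then have ij: "i < m * p" "j < n * q" by auto
  have *: "kronecker (f s) (g t) $$ (i, j) = f s $$ (i div p, j div q) * g t $$ (i mod p, j mod q)"
    if "s \<in> S" "t \<in> T" for s t
    using ij assms(1)[OF that(1)] assms(2)[OF that(2)] by auto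
  have "kronecker (lin_comb m n S c f) (lin_comb p q T d g) $$ (i, j) =
      (\<Sum>s\<in>S. \<Sum>t\<in>T. c s * f s $$ (i div p, j div q) * (d t * g t $$ (i mod p, j mod q)))"
    using ij by (simp add: div_less_mult mod_less_mult sum_product)
  also have "\<dots> = (\<Sum>s\<in>S. \<Sum>t\<in>T. c s * d t * kronecker (f s) (g t) $$ (i, j))"
    by (intro sum.cong refl) (simp add: * mult.assoc mult.left_commute)
  also have "\<dots> = ?R $$ (i, j)"
    using ij by (simp add: sum.cartesian_product case_prod_beta')
  finally show "kronecker (lin_comb m n S c f) (lin_comb p q T d g) $$ (i, j) = ?R $$ (i, j)" .
qed auto

lemma lin_comb_reindex:
  assumes "bij_betw h S T"
  shows "lin_comb m n S (\<lambda>s. c (h s)) (\<lambda>s. f (h s)) = lin_comb m n T c f"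
  using sum.reindex_bij_betw[OF assms, of "\<lambda>t. c t * f t $$ _"] by (auto intro!: eq_matI)

lemma lin_comb_const:
  assumes "X \<in> carrier_mat m n"
  shows "lin_comb m n S c (\<lambda>s. d s \<cdot>\<^sub>m X) = (\<Sum>s\<in>S. c s * d s) \<cdot>\<^sub>m X"
  using assms by (auto intro!: eq_matI simp: sum_distrib_right mult.assoc)

text \<open>If T moves each spectral projection to one with a permuted label, it moves functions of
  the spectrum accordingly. With \<tau> the identity this handles intertwiners; with \<tau> the dual
  action it handles the operators of the representation itself.\<close>

lemma lin_comb_intertwine:
  fixes E :: "'x::finite \<Rightarrow> complex mat"
  assumes "T \<in> carrier_mat m n" "\<And>x. E x \<in> carrier_mat n n" "\<And>x. D x \<in> carrier_mat m m"
    and "\<And>x. T * E x = D (\<tau> x) * T" "bij \<tau>"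
  shows "T * lin_comb n n UNIV (\<lambda>x. f (\<tau> x)) E = lin_comb m m UNIV f D * T"
  using assms lin_comb_reindex[OF assms(5), of m n f "\<lambda>x. D x * T"]
  by (simp add: lin_comb_mult_left[where m = n and l = m] lin_comb_mult_right[where m = m and n = m and l = n])

definition kron_fam :: "('x \<Rightarrow> complex mat) \<Rightarrow> ('y \<Rightarrow> complex mat) \<Rightarrow> 'x \<times> 'y \<Rightarrow> complex mat" where
  "kron_fam E D = (\<lambda>(x, y). kronecker (E x) (D y))"

lemma kron_fam_carrier:
  assumes "\<And>x. E x \<in> carrier_mat m m" "\<And>y. D y \<in> carrier_mat n n"
  shows "kron_fam E D z \<in> carrier_mat (m * n) (m * n)"
  using assms by (auto simp: kron_fam_def split: prod.split)

lemma kronecker_lin_comb_fam: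
  fixes E :: "'x::finite \<Rightarrow> complex mat" and D :: "'y::finite \<Rightarrow> complex mat"
  assumes "\<And>x. E x \<in> carrier_mat m m" "\<And>y. D y \<in> carrier_mat n n"
  shows "kronecker (lin_comb m m UNIV f E) (lin_comb n n UNIV g D) =
    lin_comb (m * n) (m * n) UNIV (\<lambda>(x, y). f x * g y) (kron_fam E D)"
  using assms by (subst kronecker_lin_comb) (auto simp: kron_fam_def)

subsection \<open>Resolutions of the identity and their functional calculus\<close>

locale resolution =
  fixes n :: nat and E :: "'x::finite \<Rightarrow> complex mat"
  assumes proj_carrier: "E x \<in> carrier_mat n n"
    and proj_orthogonal: "E x * E y = of_bool (x = y) \<cdot>\<^sub>m E x"
    and proj_adjoint: "mat_adjoint (E x) = E x"
    and proj_total: "lin_comb n n UNIV (\<lambda>_. 1) E = 1\<^sub>m n"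
begin

text \<open>Orthogonality kills the off-diagonal terms of the double sum. Operator products thereby
  turn into pointwise products of scalar functions, where the cocycle identities can be
  applied.\<close>

lemma calc_mult:
  "lin_comb n n UNIV f E * lin_comb n n UNIV g E = lin_comb n n UNIV (\<lambda>x. f x * g x) E"
proof -
  have "E x * lin_comb n n UNIV g E = g x \<cdot>\<^sub>m E x" for x
  proof -
    have "E x * lin_comb n n UNIV g E = (\<Sum>y\<in>UNIV. g y * of_bool (x = y)) \<cdot>\<^sub>m E x"
      by (simp add: lin_comb_mult_left[where m = n and l = n] proj_carrier proj_orthogonal lin_comb_const)
    then show ?thesis by (simp add: of_bool_def if_distrib[of "\<lambda>z. _ * z"] sum.delta cong: if_cong)
  qed
  then show ?thesis
    by (simp add: lin_comb_mult_right[where m = n and n = n and l = n] proj_carrier lin_comb_smult)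
qed

lemma calc_adjoint: "mat_adjoint (lin_comb n n UNIV f E) = lin_comb n n UNIV (\<lambda>x. cnj (f x)) E"
  by (simp add: lin_comb_adjoint proj_carrier proj_adjoint)

lemma calc_unitary:
  assumes "\<And>x. cnj (f x) * f x = 1"
  shows "lin_comb n n UNIV f E \<in> carrier (unitary_group n)"
  using assms by (simp add: unitary_group_def calc_adjoint calc_mult proj_total mult.commute)

end

lemma resolution_kron_fam:
  assumes "resolution m E" "resolution n D"
  shows "resolution (m * n) (kron_fam E D)"
proof -
  interpret E: resolution m E by fact
  interpret D: resolution n D by fact
  have smult: "kronecker (a \<cdot>\<^sub>m A) (b \<cdot>\<^sub>m B) = (a * b) \<cdot>\<^sub>m kronecker A B" for a b A B
    by (rule eq_matI) (auto simp: div_less_mult mod_less_mult)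
  show ?thesis
  proof
    show "kron_fam E D x \<in> carrier_mat (m * n) (m * n)" for x
      by (rule kron_fam_carrier) (rule E.proj_carrier D.proj_carrier)+
    show "mat_adjoint (kron_fam E D x) = kron_fam E D x" for x
      by (simp add: kron_fam_def kronecker_adjoint E.proj_adjoint D.proj_adjoint split: prod.split)
    show "kron_fam E D x * kron_fam E D y = of_bool (x = y) \<cdot>\<^sub>m kron_fam E D x" for x y
      by (cases x; cases y)
        (simp add: kron_fam_def kronecker_mult[OF E.proj_carrier E.proj_carrier D.proj_carrier D.proj_carrier, symmetric]
          E.proj_orthogonal D.proj_orthogonal smult flip: of_bool_conj)
    show "lin_comb (m * n) (m * n) UNIV (\<lambda>_. 1) (kron_fam E D) = 1\<^sub>m (m * n)"
      using kronecker_lin_comb_fam[where E = E and D = D and f = "\<lambda>_. 1" and g = "\<lambda>_. 1",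
          OF E.proj_carrier D.proj_carrier]
      by (simp add: E.proj_total D.proj_total case_prod_beta')
  qed
qed

text \<open>
  \<open>coarsening n s E D\<close> says that E is obtained from D by merging the projections with the
  same s-value, so that the functional calculus of E at f is that of D at f o s.
\<close>

definition coarsening :: "nat \<Rightarrow> ('y \<Rightarrow> 'x) \<Rightarrow> ('x \<Rightarrow> complex mat) \<Rightarrow> ('y::finite \<Rightarrow> complex mat) \<Rightarrow> bool" where
  "coarsening n s E D \<longleftrightarrow> (\<forall>x. E x = lin_comb n n UNIV (\<lambda>y. of_bool (s y = x)) D)"

lemma coarsening_refl: "(\<And>x. E x \<in> carrier_mat n n) \<Longrightarrow> coarsening n (\<lambda>x. x) E E"
  by (simp add: coarsening_def lin_comb_delta)

lemma coarsening_kron_fam: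
  assumes "coarsening m s E E'" "coarsening n t D D'"
    and "\<And>x. E' x \<in> carrier_mat m m" "\<And>y. D' y \<in> carrier_mat n n"
  shows "coarsening (m * n) (map_prod s t) (kron_fam E D) (kron_fam E' D')"
  using assms(1,2) unfolding coarsening_def
  by (auto simp: kron_fam_def[of E D] kronecker_lin_comb_fam[OF assms(3,4)] case_prod_beta'
      intro!: lin_comb_cong split: prod.splits)

lemma coarsening_calc:
  fixes E :: "'x::finite \<Rightarrow> complex mat"
  assumes "coarsening n s E D"
  shows "lin_comb n n UNIV f E = lin_comb n n UNIV (\<lambda>y. f (s y)) D"
proof -
  have "lin_comb n n UNIV f E = lin_comb n n UNIV f (\<lambda>x. lin_comb n n UNIV (\<lambda>y. of_bool (s y = x)) D)"
    using assms by (intro lin_comb_cong refl) (simp only: coarsening_def)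
  also have "\<dots> = lin_comb n n UNIV (\<lambda>y. \<Sum>x\<in>UNIV. f x * of_bool (s y = x)) D"
    by (rule lin_comb_lin_comb)
  also have "\<dots> = lin_comb n n UNIV (\<lambda>y. f (s y)) D"
    by (simp add: of_bool_def if_distrib[of "\<lambda>z. _ * z"] sum.delta cong: if_cong)
  finally show ?thesis .
qed

subsection \<open>Unitary representations\<close>

lemma group_unitary_group: "group (unitary_group n)"
proof (rule groupI)
  fix A assume A: "A \<in> carrier (unitary_group n)"
  then have "mat_adjoint A \<in> carrier (unitary_group n)"
    and "mat_adjoint A \<otimes>\<^bsub>unitary_group n\<^esub> A = \<one>\<^bsub>unitary_group n\<^esub>"
  proof -
    have "mat_adjoint (mat_adjoint A) = A" by (rule eq_matI) auto
    with A show "mat_adjoint A \<in> carrier (unitary_group n)"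
      "mat_adjoint A \<otimes>\<^bsub>unitary_group n\<^esub> A = \<one>\<^bsub>unitary_group n\<^esub>"
      by (auto simp: unitary_group_def)
  qed
  then show "\<exists>B\<in>carrier (unitary_group n). B \<otimes>\<^bsub>unitary_group n\<^esub> A = \<one>\<^bsub>unitary_group n\<^esub>" by blast
next
  fix A B assume "A \<in> carrier (unitary_group n)" "B \<in> carrier (unitary_group n)"
  then have A: "A \<in> carrier_mat n n" "mat_adjoint A * A = 1\<^sub>m n" "A * mat_adjoint A = 1\<^sub>m n"
    and B: "B \<in> carrier_mat n n" "mat_adjoint B * B = 1\<^sub>m n" "B * mat_adjoint B = 1\<^sub>m n"
    by (auto simp: unitary_group_def)
  note A' = mat_adjoint_carrier[OF A(1)] and B' = mat_adjoint_carrier[OF B(1)]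
  have "mat_adjoint B * mat_adjoint A * (A * B) = mat_adjoint B * (mat_adjoint A * A * B)"
    using assoc_mult_mat[OF B' A' mult_carrier_mat[OF A(1) B(1)]] assoc_mult_mat[OF A' A(1) B(1)] by simp
  moreover have "A * B * (mat_adjoint B * mat_adjoint A) = A * (B * mat_adjoint B * mat_adjoint A)"
    using assoc_mult_mat[OF A(1) B(1) mult_carrier_mat[OF B' A']] assoc_mult_mat[OF B(1) B' A'] by simp
  ultimately show "A \<otimes>\<^bsub>unitary_group n\<^esub> B \<in> carrier (unitary_group n)"
    using A B A' B' by (simp add: unitary_group_def mat_adjoint_mult[OF A(1) B(1)])
qed (auto simp: unitary_group_def)

lemma unitary_groupD:
  assumes "A \<in> carrier (unitary_group n)"
  shows "A \<in> carrier_mat n n" "mat_adjoint A * A = 1\<^sub>m n" "A * mat_adjoint A = 1\<^sub>m n"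
  using assms by (auto simp: unitary_group_def)

lemma unitary_group_mult_closed:
  "A \<in> carrier (unitary_group n) \<Longrightarrow> B \<in> carrier (unitary_group n) \<Longrightarrow> A * B \<in> carrier (unitary_group n)"
  using monoid.m_closed[OF group.is_monoid[OF group_unitary_group], of A n B] by (simp add: unitary_group_def)

context group
begin

lemma rep_props:
  assumes "\<pi> \<in> hom G (unitary_group n)"
  shows "g \<in> carrier G \<Longrightarrow> \<pi> g \<in> carrier (unitary_group n)"
    and "g \<in> carrier G \<Longrightarrow> \<pi> g \<in> carrier_mat n n"
    and "g \<in> carrier G \<Longrightarrow> h \<in> carrier G \<Longrightarrow> \<pi> (g \<otimes> h) = \<pi> g * \<pi> h"
    and "\<pi> \<one> = 1\<^sub>m n"
    and "g \<in> carrier G \<Longrightarrow> mat_adjoint (\<pi> g) = \<pi> (inv g)"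
proof -
  show c: "\<pi> g \<in> carrier (unitary_group n)" if "g \<in> carrier G" for g
    using assms that by (auto simp: hom_def)
  then show c': "\<pi> g \<in> carrier_mat n n" if "g \<in> carrier G" for g
    using that by (auto simp: unitary_group_def)
  show m: "\<pi> (g \<otimes> h) = \<pi> g * \<pi> h" if "g \<in> carrier G" "h \<in> carrier G" for g h
    using assms that by (auto simp: hom_def unitary_group_def)
  show one: "\<pi> \<one> = 1\<^sub>m n"
    using hom_one[OF assms is_group group_unitary_group] by (simp add: unitary_group_def)
  show "mat_adjoint (\<pi> g) = \<pi> (inv g)" if g: "g \<in> carrier G" for g
  proof -
    have "\<pi> (inv g) * \<pi> g = 1\<^sub>m n" using g by (simp flip: m add: one)
    moreover have "\<pi> g * mat_adjoint (\<pi> g) = 1\<^sub>m n" using unitary_groupD[OF c[OF g]] by simp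
    ultimately show ?thesis
      using assoc_mult_mat[OF c'[OF inv_closed[OF g]] c'[OF g] mat_adjoint_carrier[OF c'[OF g]]]
        left_mult_one_mat[OF mat_adjoint_carrier[OF c'[OF g]]] right_mult_one_mat[OF c'[OF inv_closed[OF g]]]
      by simp
  qed
qed

end

subsection \<open>Spectral projections of a normal abelian subgroup\<close>

text \<open>The type \<open>'x\<close> plays the role of the dual group of A. The two summation
  axioms make the pairing perfect: the first gives orthogonality of characters, the second lets
  characters separate the points of A, which is what Fourier inversion uses.\<close>

locale dual_pair = group G for G (structure) +
  fixes A :: "'a set" and e :: "'x::{finite, ab_group_add} \<Rightarrow> 'a \<Rightarrow> complex"
  assumes A_subgroup: "subgroup A G" and A_finite: "finite A"
    and e_add: "a \<in> A \<Longrightarrow> e (\<chi> + \<psi>) a = e \<chi> a * e \<psi> a"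
    and e_mult: "a \<in> A \<Longrightarrow> b \<in> A \<Longrightarrow> e \<chi> (a \<otimes> b) = e \<chi> a * e \<chi> b"
    and e_norm: "a \<in> A \<Longrightarrow> cnj (e \<chi> a) * e \<chi> a = 1"
    and e_sum: "(\<Sum>a\<in>A. e \<chi> a) = of_bool (\<chi> = 0) * of_nat (card A)"
    and e_sum_dual: "a \<in> A \<Longrightarrow> (\<Sum>\<chi>\<in>UNIV. e \<chi> a) = of_bool (a = \<one>) * of_nat (card A)"
begin

lemma A_carrier [simp]: "a \<in> A \<Longrightarrow> a \<in> carrier G"
  using subgroup.mem_carrier[OF A_subgroup] .

lemma A_inv: "a \<in> A \<Longrightarrow> inv a \<in> A" and A_mult: "a \<in> A \<Longrightarrow> b \<in> A \<Longrightarrow> a \<otimes> b \<in> A"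
  using subgroup.m_inv_closed[OF A_subgroup] subgroup.m_closed[OF A_subgroup] by auto

lemma card_A: "card A \<noteq> 0"
  using A_finite subgroup.one_closed[OF A_subgroup] by auto

lemma e_zero: "a \<in> A \<Longrightarrow> e 0 a = 1"
  using e_add[of a 0 0] e_norm[of a 0] by (auto simp: algebra_simps)

lemma e_minus: "a \<in> A \<Longrightarrow> cnj (e \<chi> a) = e (- \<chi>) a"
  using e_add[of a "- \<chi>" \<chi>] e_norm[of a \<chi>] e_zero[of a]
  by (metis ab_left_minus mult_right_cancel mult_zero_right zero_neq_one)

lemma e_one: "e \<chi> \<one> = 1"
  using e_mult[of \<one> \<one> \<chi>] e_norm[of \<one> \<chi>] subgroup.one_closed[OF A_subgroup] by auto

lemma e_inv: "a \<in> A \<Longrightarrow> e \<chi> (inv a) = cnj (e \<chi> a)"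
  using e_mult[of "inv a" a \<chi>] e_norm[of a \<chi>] A_inv[of a] e_one[of \<chi>]
  by (metis A_carrier l_inv mult_right_cancel mult_zero_right zero_neq_one)

lemma e_orthogonal: "(\<Sum>a\<in>A. cnj (e \<chi> a) * e \<psi> a) = of_bool (\<chi> = \<psi>) * of_nat (card A)"
proof -
  have "(\<Sum>a\<in>A. cnj (e \<chi> a) * e \<psi> a) = (\<Sum>a\<in>A. e (- \<chi> + \<psi>) a)"
    by (intro sum.cong refl) (simp only: e_add e_minus)
  also have "\<dots> = of_bool (- \<chi> + \<psi> = 0) * of_nat (card A)"
    by (rule e_sum)
  also have "- \<chi> + \<psi> = 0 \<longleftrightarrow> \<chi> = \<psi>"
    by (auto simp: add.commute eq_neg_iff_add_eq_0)
  finally show ?thesis .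
qed

lemma e_orthogonal_dual:
  assumes "a \<in> A" "b \<in> A"
  shows "(\<Sum>\<chi>\<in>UNIV. cnj (e \<chi> b) * e \<chi> a) = of_bool (b = a) * of_nat (card A)"
proof -
  have "(\<Sum>\<chi>\<in>UNIV. cnj (e \<chi> b) * e \<chi> a) = (\<Sum>\<chi>\<in>UNIV. e \<chi> (inv b \<otimes> a))"
    using assms by (intro sum.cong refl) (simp only: e_mult e_inv A_inv)
  also have "\<dots> = of_bool (inv b \<otimes> a = \<one>) * of_nat (card A)"
    using assms by (intro e_sum_dual A_mult A_inv)
  also have "inv b \<otimes> a = \<one> \<longleftrightarrow> b = a"
    using assms inv_solve_left'[of \<one> b a] by auto
  finally show ?thesis .
qed

definition spec :: "nat \<Rightarrow> ('a \<Rightarrow> complex mat) \<Rightarrow> 'x \<Rightarrow> complex mat" where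
  "spec n \<pi> \<chi> = lin_comb n n A (\<lambda>a. cnj (e \<chi> a) / of_nat (card A)) \<pi>"

lemma spec_carrier: "spec n \<pi> \<chi> \<in> carrier_mat n n"
  by (simp add: spec_def)

text \<open>The projection is an average over A, so an operator that permutes A by \<sigma> permutes
  the projections by the dual of \<sigma>. Both intertwiners (\<sigma> the identity) and group
  elements (\<sigma> conjugation) are instances.\<close>

lemma spec_intertwine:
  assumes "T \<in> carrier_mat m n" "bij_betw \<sigma> A A"
    and "\<And>a. a \<in> A \<Longrightarrow> \<pi> a \<in> carrier_mat n n" "\<And>a. a \<in> A \<Longrightarrow> \<rho> a \<in> carrier_mat m m"
    and "\<And>a. a \<in> A \<Longrightarrow> T * \<pi> a = \<rho> (\<sigma> a) * T"
    and "\<And>a. a \<in> A \<Longrightarrow> e \<chi> a = e \<psi> (\<sigma> a)"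
  shows "T * spec n \<pi> \<chi> = spec m \<rho> \<psi> * T"
proof -
  let ?c = "\<lambda>\<chi> a. cnj (e \<chi> a) / of_nat (card A)"
  have "T * spec n \<pi> \<chi> = lin_comb m n A (?c \<chi>) (\<lambda>a. T * \<pi> a)"
    unfolding spec_def using assms by (intro lin_comb_mult_left)
  also have "\<dots> = lin_comb m n A (\<lambda>a. ?c \<psi> (\<sigma> a)) (\<lambda>a. \<rho> (\<sigma> a) * T)"
    using assms by (intro lin_comb_cong) auto
  also have "\<dots> = lin_comb m n A (?c \<psi>) (\<lambda>a. \<rho> a * T)"
    by (rule lin_comb_reindex[OF assms(2)])
  also have "\<dots> = spec m \<rho> \<psi> * T"
    unfolding spec_def using assms by (intro lin_comb_mult_right[symmetric])
  finally show ?thesis .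
qed

text \<open>By orthogonality of characters, averaging a family on which A acts through the
  characters s(y) picks out exactly the members with s(y) = \<chi>. It identifies the spectrum of
  tensor products and of the unit from their factors.\<close>

lemma spec_coarsening:
  assumes "\<And>a. a \<in> A \<Longrightarrow> \<pi> a = lin_comb n n UNIV (\<lambda>y. e (s y) a) D"
  shows "coarsening n s (spec n \<pi>) D"
proof -
  have "spec n \<pi> \<chi> = lin_comb n n UNIV (\<lambda>y. of_bool (s y = \<chi>)) D" for \<chi>
  proof -
    have "spec n \<pi> \<chi> = lin_comb n n A (\<lambda>a. cnj (e \<chi> a) / of_nat (card A)) (\<lambda>a. lin_comb n n UNIV (\<lambda>y. e (s y) a) D)"
      unfolding spec_def using assms by (intro lin_comb_cong) auto
    also have "\<dots> = lin_comb n n UNIV (\<lambda>y. of_bool (s y = \<chi>)) D"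
      unfolding lin_comb_lin_comb using e_orthogonal[of \<chi>] card_A
      by (intro lin_comb_cong refl) (auto simp flip: sum_divide_distrib)
    finally show ?thesis .
  qed
  then show ?thesis by (simp add: coarsening_def)
qed

context
  fixes n \<pi> assumes \<pi>: "\<pi> \<in> hom G (unitary_group n)"
begin

text \<open>Fourier inversion on A: evaluation at a is the spectral function of \<pi>(a).
  Conversely, a phase that happens to be such an evaluation can be absorbed into the group.\<close>

lemma spec_calc:
  assumes "a \<in> A"
  shows "lin_comb n n UNIV (\<lambda>\<chi>. e \<chi> a) (spec n \<pi>) = \<pi> a"
proof -
  have "lin_comb n n UNIV (\<lambda>\<chi>. e \<chi> a) (spec n \<pi>) =
      lin_comb n n A (\<lambda>b. \<Sum>\<chi>\<in>UNIV. e \<chi> a * (cnj (e \<chi> b) / of_nat (card A))) \<pi>"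
    unfolding spec_def by (rule lin_comb_lin_comb)
  also have "\<dots> = lin_comb n n A (\<lambda>b. of_bool (b = a)) \<pi>"
    using e_orthogonal_dual[OF assms] card_A
    by (intro lin_comb_cong refl) (auto simp: mult.commute simp flip: sum_divide_distrib)
  also have "\<dots> = \<pi> a"
    using assms A_finite by (intro lin_comb_delta rep_props[OF \<pi>]) auto
  finally show ?thesis .
qed

lemma spec_eigen:
  assumes a: "a \<in> A"
  shows "\<pi> a * spec n \<pi> \<chi> = e \<chi> a \<cdot>\<^sub>m spec n \<pi> \<chi>"
proof -
  let ?c = "\<lambda>b. cnj (e \<chi> b) / of_nat (card A)"
  have bij: "bij_betw (\<lambda>b. a \<otimes> b) A A"
    using a A_mult A_inv
    by (intro bij_betwI[where g = "\<lambda>b. inv a \<otimes> b"]) (auto simp flip: m_assoc)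
  have "\<pi> a * spec n \<pi> \<chi> = lin_comb n n A ?c (\<lambda>b. \<pi> (a \<otimes> b))"
    using a by (simp add: spec_def lin_comb_mult_left[where m = n] rep_props[OF \<pi>] cong: lin_comb_cong)
  also have "\<dots> = lin_comb n n A (\<lambda>b. e \<chi> a * ?c (a \<otimes> b)) (\<lambda>b. \<pi> (a \<otimes> b))"
    using a e_norm[of a \<chi>] by (intro lin_comb_cong refl) (simp add: e_mult mult.commute mult.left_commute)
  also have "\<dots> = lin_comb n n A (\<lambda>b. e \<chi> a * ?c b) \<pi>"
    by (rule lin_comb_reindex[OF bij])
  finally show ?thesis by (simp add: spec_def smult_lin_comb)
qed

lemma spec_resolution: "resolution n (spec n \<pi>)"
proof
  show "spec n \<pi> x \<in> carrier_mat n n" for x by (rule spec_carrier)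
  show "spec n \<pi> x * spec n \<pi> y = of_bool (x = y) \<cdot>\<^sub>m spec n \<pi> x" for x y
  proof -
    have "spec n \<pi> x * spec n \<pi> y =
        lin_comb n n A (\<lambda>a. cnj (e x a) / of_nat (card A)) (\<lambda>a. \<pi> a * spec n \<pi> y)"
      unfolding spec_def[of _ _ x]
      by (rule lin_comb_mult_right) (auto intro: rep_props[OF \<pi>] spec_carrier)
    also have "\<dots> = (\<Sum>a\<in>A. cnj (e x a) / of_nat (card A) * e y a) \<cdot>\<^sub>m spec n \<pi> y"
      by (simp add: spec_eigen lin_comb_const spec_carrier cong: lin_comb_cong)
    also have "(\<Sum>a\<in>A. cnj (e x a) / of_nat (card A) * e y a) = of_bool (x = y)"
      using e_orthogonal[of x y] card_A by (simp flip: sum_divide_distrib)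
    finally show ?thesis using carrier_matD[OF spec_carrier[of n \<pi>]] by (cases "x = y") (auto intro!: eq_matI)
  qed
  show "mat_adjoint (spec n \<pi> x) = spec n \<pi> x" for x
  proof -
    have bij: "bij_betw (\<lambda>a. inv a) A A"
      using A_inv by (intro bij_betwI[where g = "\<lambda>a. inv a"]) auto
    have "mat_adjoint (spec n \<pi> x) =
        lin_comb n n A (\<lambda>a. cnj (e x (inv a)) / of_nat (card A)) (\<lambda>a. \<pi> (inv a))"
      by (simp add: spec_def lin_comb_adjoint rep_props[OF \<pi>] e_inv cong: lin_comb_cong)
    also have "\<dots> = spec n \<pi> x"
      unfolding spec_def by (rule lin_comb_reindex[OF bij])
    finally show ?thesis .
  qed
  show "lin_comb n n UNIV (\<lambda>_. 1) (spec n \<pi>) = 1\<^sub>m n"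
    using spec_calc[OF subgroup.one_closed[OF A_subgroup]] by (simp add: e_one rep_props[OF \<pi>])
qed

end

lemma spec_tensor:
  assumes "\<pi> \<in> hom G (unitary_group m)" "\<rho> \<in> hom G (unitary_group n)"
  shows "coarsening (m * n) (\<lambda>(\<chi>, \<psi>). \<chi> + \<psi>) (spec (m * n) (\<lambda>g\<in>carrier G. kronecker (\<pi> g) (\<rho> g)))
    (kron_fam (spec m \<pi>) (spec n \<rho>))"
proof (rule spec_coarsening)
  fix a assume a: "a \<in> A"
  have "kronecker (\<pi> a) (\<rho> a) =
      lin_comb (m * n) (m * n) UNIV (\<lambda>(\<chi>, \<psi>). e \<chi> a * e \<psi> a) (kron_fam (spec m \<pi>) (spec n \<rho>))"
    unfolding spec_calc[OF assms(1) a, symmetric] spec_calc[OF assms(2) a, symmetric]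
    by (rule kronecker_lin_comb_fam) (rule spec_carrier)+
  then show "(\<lambda>g\<in>carrier G. kronecker (\<pi> g) (\<rho> g)) a =
      lin_comb (m * n) (m * n) UNIV (\<lambda>y. e (case y of (\<chi>, \<psi>) \<Rightarrow> \<chi> + \<psi>) a) (kron_fam (spec m \<pi>) (spec n \<rho>))"
    using a by (simp add: case_prod_beta' e_add)
qed

text \<open>The spectrum of the trivial representation is a single point labelled 0. Indexing it by
  \<open>unit\<close> lets the normalization of \<beta> at 0 apply without a sum over the remaining
  characters.\<close>

lemma spec_unit:
  "coarsening 1 (\<lambda>_::unit. 0) (spec 1 (\<lambda>g\<in>carrier G. 1\<^sub>m 1)) (\<lambda>_. 1\<^sub>m 1)"
  by (rule spec_coarsening) (auto simp: e_zero intro!: eq_matI)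

end

lemma resolution_unit: "resolution 1 (\<lambda>_::unit. 1\<^sub>m 1)"
  by standard (auto intro!: eq_matI)

section \<open>The data of \<open>Rep\<close> in terms of matrices\<close>

lemma Objs_Rep: "(n, \<pi>) \<in> Objs (Rep G) \<longleftrightarrow> \<pi> \<in> hom G (unitary_group n) \<and> \<pi> \<in> extensional (carrier G)"
  by (simp add: Rep_def)

lemma Mors_Rep: "T \<in> Mors (Rep G) (m, \<pi>) (n, \<rho>) \<longleftrightarrow>
    T \<in> carrier_mat n m \<and> (\<forall>g\<in>carrier G. T * \<pi> g = \<rho> g * T)"
  by (simp add: Rep_def)

lemma Rep_simps:
  "id_mor (Rep G) (n, \<pi>) = 1\<^sub>m n" "comp_mor (Rep G) = (*)" "add_mor (Rep G) = (+)"
  "scale_mor (Rep G) = (\<cdot>\<^sub>m)" "star_mor (Rep G) = mat_adjoint"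
  "tensor_obj (Rep G) (m, \<pi>) (n, \<rho>) = (m * n, \<lambda>g\<in>carrier G. kronecker (\<pi> g) (\<rho> g))"
  "tensor_mor (Rep G) = kronecker" "unit_obj (Rep G) = (1, \<lambda>g\<in>carrier G. 1\<^sub>m 1)"
  "associator (Rep G) (m, \<pi>) (n, \<rho>) (l, \<sigma>) = 1\<^sub>m (m * n * l)"
  "left_unitor (Rep G) (n, \<pi>) = 1\<^sub>m n" "right_unitor (Rep G) (n, \<pi>) = 1\<^sub>m n"
  by (simp_all add: Rep_def)

subsection \<open>Twisting by a cocycle on the dual\<close>

text \<open>
  The map \<open>\<phi>\<close> need not be a homomorphism: \<open>h \<mapsto> \<phi> h \<cdot> \<Sum>\<^sub>\<chi> \<eta>(\<phi> h, \<chi>) e\<^sub>\<chi>\<close>, with \<open>e\<^sub>\<chi>\<close> the idempotents of A,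
  is multiplicative into the group algebra of G, and \<open>\<beta>\<close> is the inverse of the cocycle that twists
  the coproduct.
\<close>

locale twist = dual_pair G A e for G (structure) and A
  and e :: "'x::{finite, ab_group_add} \<Rightarrow> 'a \<Rightarrow> complex" +
  fixes H :: "('h, 'd) monoid_scheme" and \<phi> :: "'h \<Rightarrow> 'a" and act :: "'a \<Rightarrow> 'x \<Rightarrow> 'x"
    and \<eta> :: "'a \<Rightarrow> 'x \<Rightarrow> complex" and \<beta> :: "'x \<Rightarrow> 'x \<Rightarrow> complex"
  assumes group_H: "group H"
    and \<phi>_carrier: "h \<in> carrier H \<Longrightarrow> \<phi> h \<in> carrier G"
    and conj_A: "g \<in> carrier G \<Longrightarrow> a \<in> A \<Longrightarrow> g \<otimes> a \<otimes> inv g \<in> A"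
    and act_bij: "g \<in> carrier G \<Longrightarrow> bij (act g)"
    and e_act: "g \<in> carrier G \<Longrightarrow> a \<in> A \<Longrightarrow> e (act g \<chi>) (g \<otimes> a \<otimes> inv g) = e \<chi> a"
    and \<phi>_mult: "h \<in> carrier H \<Longrightarrow> k \<in> carrier H \<Longrightarrow>
      \<exists>b\<in>A. \<phi> (h \<otimes>\<^bsub>H\<^esub> k) = \<phi> h \<otimes> \<phi> k \<otimes> b \<and>
        (\<forall>\<chi>. e \<chi> b * \<eta> (\<phi> (h \<otimes>\<^bsub>H\<^esub> k)) \<chi> = \<eta> (\<phi> h) (act (\<phi> k) \<chi>) * \<eta> (\<phi> k) \<chi>)"
    and \<eta>_norm: "g \<in> carrier G \<Longrightarrow> cnj (\<eta> g \<chi>) * \<eta> g \<chi> = 1"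
    and \<beta>_norm: "cnj (\<beta> \<chi> \<psi>) * \<beta> \<chi> \<psi> = 1"
    and \<beta>_\<eta>: "g \<in> carrier G \<Longrightarrow>
      \<beta> (act g \<chi>) (act g \<psi>) * (\<eta> g \<chi> * \<eta> g \<psi>) = \<eta> g (\<chi> + \<psi>) * \<beta> \<chi> \<psi>"
    and \<beta>_cocycle: "\<beta> (\<chi> + \<psi>) \<omega> * \<beta> \<chi> \<psi> = \<beta> \<chi> (\<psi> + \<omega>) * \<beta> \<psi> \<omega>"
    and \<beta>_zero: "\<beta> 0 \<chi> = 1" "\<beta> \<chi> 0 = 1"
begin

abbreviation calc :: "nat \<Rightarrow> ('a \<Rightarrow> complex mat) \<Rightarrow> ('x \<Rightarrow> complex) \<Rightarrow> complex mat" where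
  "calc n \<pi> f \<equiv> lin_comb n n UNIV f (spec n \<pi>)"

definition twist_rep :: "nat \<Rightarrow> ('a \<Rightarrow> complex mat) \<Rightarrow> 'h \<Rightarrow> complex mat" where
  "twist_rep n \<pi> = (\<lambda>h\<in>carrier H. \<pi> (\<phi> h) * calc n \<pi> (\<eta> (\<phi> h)))"

definition twist_tensor :: "nat \<Rightarrow> ('a \<Rightarrow> complex mat) \<Rightarrow> nat \<Rightarrow> ('a \<Rightarrow> complex mat) \<Rightarrow> complex mat" where
  "twist_tensor m \<pi> n \<rho> =
     lin_comb (m * n) (m * n) UNIV (\<lambda>(\<chi>, \<psi>). \<beta> \<chi> \<psi>) (kron_fam (spec m \<pi>) (spec n \<rho>))"

text \<open>Spaces and intertwiners stay the same; only the action and the identification of tensor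
  products change. The comparison of units can be the identity because \<beta> is normalized at
  0.\<close>

definition twist_functor ::
  "(nat \<times> ('a \<Rightarrow> complex mat), complex mat, nat \<times> ('h \<Rightarrow> complex mat), complex mat) tensor_functor"
  where
  "twist_functor =
     \<lparr>fun_obj = (\<lambda>(n, \<pi>). (n, twist_rep n \<pi>)), fun_mor = (\<lambda>X Y T. T), fun_unit = 1\<^sub>m 1,
      fun_tensor = (\<lambda>(m, \<pi>) (n, \<rho>). twist_tensor m \<pi> n \<rho>)\<rparr>"

lemma conj_bij:
  assumes g: "g \<in> carrier G"
  shows "bij_betw (\<lambda>a. g \<otimes> a \<otimes> inv g) A A"
proof (rule bij_betwI[where g = "\<lambda>a. inv g \<otimes> a \<otimes> g"])
  show "(\<lambda>a. inv g \<otimes> a \<otimes> g) \<in> A \<rightarrow> A" using conj_A[OF inv_closed[OF g]] g by simp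
qed (use g conj_A in \<open>auto simp: m_assoc inv_solve_left inv_solve_right' simp flip: m_assoc[of g "inv g"] m_assoc[of "inv g" g]\<close>)

lemma spec_act:
  assumes \<pi>: "\<pi> \<in> hom G (unitary_group n)" and g: "g \<in> carrier G"
  shows "\<pi> g * spec n \<pi> \<chi> = spec n \<pi> (act g \<chi>) * \<pi> g"
proof (rule spec_intertwine[OF rep_props(2)[OF \<pi> g] conj_bij[OF g]])
  fix a assume a: "a \<in> A"
  have "g \<otimes> a = g \<otimes> a \<otimes> inv g \<otimes> g" using a g by (simp add: m_assoc)
  then show "\<pi> g * \<pi> a = \<pi> (g \<otimes> a \<otimes> inv g) * \<pi> g"
    using a g by (simp flip: rep_props(3)[OF \<pi>])
  show "e \<chi> a = e (act g \<chi>) (g \<otimes> a \<otimes> inv g)" using e_act[OF g a] ..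
qed (use g in \<open>auto intro: rep_props[OF \<pi>]\<close>)

lemma twist_rep_hom:
  assumes \<pi>: "\<pi> \<in> hom G (unitary_group n)"
  shows "twist_rep n \<pi> \<in> hom H (unitary_group n)"
proof (rule homI)
  fix h assume h: "h \<in> carrier H"
  interpret resolution n "spec n \<pi>" by (rule spec_resolution[OF \<pi>])
  show "twist_rep n \<pi> h \<in> carrier (unitary_group n)"
    using h by (simp add: twist_rep_def unitary_group_mult_closed calc_unitary \<eta>_norm \<phi>_carrier rep_props(1)[OF \<pi>])
next
  fix h k assume h: "h \<in> carrier H" and k: "k \<in> carrier H"
  interpret resolution n "spec n \<pi>" by (rule spec_resolution[OF \<pi>])
  note C = rep_props(2)[OF \<pi>] and \<phi> = \<phi>_carrier[OF h] \<phi>_carrier[OF k]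
  obtain b where b: "b \<in> A" "\<phi> (h \<otimes>\<^bsub>H\<^esub> k) = \<phi> h \<otimes> \<phi> k \<otimes> b"
    "\<And>\<chi>. e \<chi> b * \<eta> (\<phi> (h \<otimes>\<^bsub>H\<^esub> k)) \<chi> = \<eta> (\<phi> h) (act (\<phi> k) \<chi>) * \<eta> (\<phi> k) \<chi>"
    using \<phi>_mult[OF h k] by blast
  have hk: "h \<otimes>\<^bsub>H\<^esub> k \<in> carrier H"
    using h k by (rule monoid.m_closed[OF group.is_monoid[OF group_H]])
  \<comment> \<open>Moving a spectral function across \<pi>(\<phi> k) precomposes it with the dual
    action of \<phi> k.\<close>
  have comm: "\<pi> (\<phi> k) * calc n \<pi> (\<lambda>\<chi>. \<eta> (\<phi> h) (act (\<phi> k) \<chi>)) = calc n \<pi> (\<eta> (\<phi> h)) * \<pi> (\<phi> k)"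
    by (rule lin_comb_intertwine[where \<tau> = "act (\<phi> k)"])
      (use C \<phi> in \<open>auto intro!: spec_carrier spec_act \<pi> act_bij\<close>)
  let ?U = "\<pi> (\<phi> h)" and ?V = "\<pi> (\<phi> k)" and ?h = "calc n \<pi> (\<eta> (\<phi> h))" and ?k = "calc n \<pi> (\<eta> (\<phi> k))"
    and ?h' = "calc n \<pi> (\<lambda>\<chi>. \<eta> (\<phi> h) (act (\<phi> k) \<chi>))" and ?b = "calc n \<pi> (\<lambda>\<chi>. e \<chi> b)"
    and ?hk = "calc n \<pi> (\<eta> (\<phi> (h \<otimes>\<^bsub>H\<^esub> k)))"
  have U: "?U \<in> carrier_mat n n" "?V \<in> carrier_mat n n" using C \<phi> by auto
  have "?U * ?h * (?V * ?k) = ?U * (?h * ?V) * ?k"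
    using U by (simp add: assoc_mult_mat[of _ n n _ n _ n] mult_carrier_mat[of _ n n _ n])
  also have "\<dots> = ?U * ?V * (?h' * ?k)"
    using U by (simp add: assoc_mult_mat[of _ n n _ n _ n] mult_carrier_mat[of _ n n _ n] flip: comm)
  \<comment> \<open>The product of the two phases exceeds the phase of the product by the character
    value at b. By Fourier inversion this excess is \<pi>(b), which is precisely the failure of
    \<phi> to be multiplicative.\<close>
  also have "?h' * ?k = ?b * ?hk"
    using b(3) by (simp add: calc_mult)
  also have "?U * ?V * (?b * ?hk) = \<pi> (\<phi> h \<otimes> \<phi> k \<otimes> b) * ?hk"
    using U b(1) \<phi> C[of b]
    by (simp add: assoc_mult_mat[of _ n n _ n _ n] mult_carrier_mat[of _ n n _ n] spec_calc[OF \<pi>] rep_props(3)[OF \<pi>])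
  finally show "twist_rep n \<pi> (h \<otimes>\<^bsub>H\<^esub> k) = twist_rep n \<pi> h \<otimes>\<^bsub>unitary_group n\<^esub> twist_rep n \<pi> k"
    using h k hk by (simp add: twist_rep_def unitary_group_def b(2))
qed

lemma twist_rep_intertwine:
  assumes "\<pi> \<in> hom G (unitary_group m)" "\<rho> \<in> hom G (unitary_group n)"
    and T: "T \<in> carrier_mat n m" "\<And>g. g \<in> carrier G \<Longrightarrow> T * \<pi> g = \<rho> g * T"
  shows "T * spec m \<pi> \<chi> = spec n \<rho> \<chi> * T"
    and "h \<in> carrier H \<Longrightarrow> T * twist_rep m \<pi> h = twist_rep n \<rho> h * T"
proof -
  show *: "T * spec m \<pi> \<chi> = spec n \<rho> \<chi> * T" for \<chi>
    by (rule spec_intertwine[where \<sigma> = "\<lambda>a. a"])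
      (use T rep_props(2)[OF assms(1)] rep_props(2)[OF assms(2)] in \<open>auto simp: bij_betw_def\<close>)
  show "T * twist_rep m \<pi> h = twist_rep n \<rho> h * T" if h: "h \<in> carrier H"
  proof -
    let ?m = "calc m \<pi> (\<eta> (\<phi> h))" and ?n = "calc n \<rho> (\<eta> (\<phi> h))"
    have C: "\<pi> (\<phi> h) \<in> carrier_mat m m" "\<rho> (\<phi> h) \<in> carrier_mat n n"
      using rep_props(2)[OF assms(1)] rep_props(2)[OF assms(2)] \<phi>_carrier[OF h] by auto
    have "T * ?m = ?n * T"
      by (rule lin_comb_intertwine[where \<tau> = "\<lambda>x. x"]) (use T * spec_carrier bij_id[unfolded id_def] in auto)
    then have "T * (\<pi> (\<phi> h) * ?m) = \<rho> (\<phi> h) * ?n * T"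
      using T(1) T(2)[OF \<phi>_carrier[OF h]] assoc_mult_mat[OF T(1) C(1), of ?m m]
        assoc_mult_mat[OF C(2) T(1), of ?m m] assoc_mult_mat[OF C(2), of ?n n T m] by simp
    then show ?thesis using h by (simp add: twist_rep_def)
  qed
qed

context
  fixes m n \<pi> \<rho>
  assumes \<pi>: "\<pi> \<in> hom G (unitary_group m)" and \<rho>: "\<rho> \<in> hom G (unitary_group n)"
begin

lemma kron_spec_resolution: "resolution (m * n) (kron_fam (spec m \<pi>) (spec n \<rho>))"
  by (intro resolution_kron_fam spec_resolution \<pi> \<rho>)

lemma twist_tensor_unitary: "twist_tensor m \<pi> n \<rho> \<in> carrier (unitary_group (m * n))"
  unfolding twist_tensor_def
  by (rule resolution.calc_unitary[OF kron_spec_resolution]) (auto simp: \<beta>_norm)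

lemma twist_tensor_intertwine:
  assumes h: "h \<in> carrier H"
  shows "twist_tensor m \<pi> n \<rho> * kronecker (twist_rep m \<pi> h) (twist_rep n \<rho> h) =
    twist_rep (m * n) (\<lambda>g\<in>carrier G. kronecker (\<pi> g) (\<rho> g)) h * twist_tensor m \<pi> n \<rho>"
proof -
  define g where "g = \<phi> h"
  have g: "g \<in> carrier G" using \<phi>_carrier[OF h] by (simp add: g_def)
  let ?E = "kron_fam (spec m \<pi>) (spec n \<rho>)" and ?J = "twist_tensor m \<pi> n \<rho>"
  let ?C = "\<lambda>f. lin_comb (m * n) (m * n) UNIV f ?E" and ?U = "kronecker (\<pi> g) (\<rho> g)"
  interpret resolution "m * n" ?E by (rule kron_spec_resolution)
  have C: "\<pi> g \<in> carrier_mat m m" "\<rho> g \<in> carrier_mat n n"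
    using rep_props(2)[OF \<pi> g] rep_props(2)[OF \<rho> g] .
  have U: "?U \<in> carrier_mat (m * n) (m * n)" using C by auto
  have 1: "kronecker (twist_rep m \<pi> h) (twist_rep n \<rho> h) = ?U * ?C (\<lambda>(\<chi>, \<psi>). \<eta> g \<chi> * \<eta> g \<psi>)"
    using h
    by (simp add: twist_rep_def kronecker_mult[OF C(1) lin_comb_carrier C(2) lin_comb_carrier]
        kronecker_lin_comb_fam[where E = "spec m \<pi>" and D = "spec n \<rho>", OF spec_carrier spec_carrier]
        flip: g_def)
  have 2: "twist_rep (m * n) (\<lambda>g\<in>carrier G. kronecker (\<pi> g) (\<rho> g)) h = ?U * ?C (\<lambda>(\<chi>, \<psi>). \<eta> g (\<chi> + \<psi>))"
    using h g by (simp add: twist_rep_def coarsening_calc[OF spec_tensor[OF \<pi> \<rho>]] case_prod_beta' flip: g_def)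
  \<comment> \<open>Conjugation by \<open>?U\<close> permutes the joint spectrum diagonally, acting
    by g on both labels.\<close>
  have 3: "?U * ?C (\<lambda>x. (\<lambda>(\<chi>, \<psi>). \<beta> \<chi> \<psi>) (map_prod (act g) (act g) x)) = ?J * ?U"
    unfolding twist_tensor_def
  proof (rule lin_comb_intertwine[OF U proj_carrier proj_carrier])
    show "bij (map_prod (act g) (act g))"
      using act_bij[OF g] by (simp add: bij_def prod.inj_map map_prod_surj)
    show "?U * ?E x = ?E (map_prod (act g) (act g) x) * ?U" for x
      using kronecker_mult[OF C(1) spec_carrier C(2) spec_carrier]
        kronecker_mult[OF spec_carrier C(1) spec_carrier C(2)] spec_act[OF \<pi> g] spec_act[OF \<rho> g]
      by (auto simp: kron_fam_def split: prod.split) metis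
  qed
  have "?J * (?U * ?C (\<lambda>(\<chi>, \<psi>). \<eta> g \<chi> * \<eta> g \<psi>)) = ?J * ?U * ?C (\<lambda>(\<chi>, \<psi>). \<eta> g \<chi> * \<eta> g \<psi>)"
    unfolding twist_tensor_def by (rule assoc_mult_mat[OF lin_comb_carrier U lin_comb_carrier, symmetric])
  also have "\<dots> = ?U * ?C (\<lambda>(\<chi>, \<psi>). \<beta> (act g \<chi>) (act g \<psi>) * (\<eta> g \<chi> * \<eta> g \<psi>))"
    unfolding 3[symmetric] assoc_mult_mat[OF U lin_comb_carrier lin_comb_carrier] calc_mult
    by (simp add: case_prod_beta')
  \<comment> \<open>Here the invariance of \<beta> up to the coboundary of \<eta> enters; \<eta> at
    the sum is the phase of the tensor product, whose spectrum is labelled by sums.\<close>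
  also have "\<dots> = ?U * ?C (\<lambda>(\<chi>, \<psi>). \<eta> g (\<chi> + \<psi>) * \<beta> \<chi> \<psi>)"
    by (simp add: \<beta>_\<eta>[OF g])
  also have "\<dots> = ?U * ?C (\<lambda>(\<chi>, \<psi>). \<eta> g (\<chi> + \<psi>)) * ?J"
    unfolding twist_tensor_def assoc_mult_mat[OF U lin_comb_carrier lin_comb_carrier] calc_mult
    by (simp add: case_prod_beta')
  finally show ?thesis unfolding 1 2 .
qed

end

lemma twist_tensor_natural:
  assumes "\<pi> \<in> hom G (unitary_group m)" "\<rho> \<in> hom G (unitary_group n)"
    and "\<pi>' \<in> hom G (unitary_group m')" "\<rho>' \<in> hom G (unitary_group n')"
    and S: "S \<in> carrier_mat m' m" "\<And>g. g \<in> carrier G \<Longrightarrow> S * \<pi> g = \<pi>' g * S"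
    and T: "T \<in> carrier_mat n' n" "\<And>g. g \<in> carrier G \<Longrightarrow> T * \<rho> g = \<rho>' g * T"
  shows "kronecker S T * twist_tensor m \<pi> n \<rho> = twist_tensor m' \<pi>' n' \<rho>' * kronecker S T"
  unfolding twist_tensor_def
proof (rule lin_comb_intertwine[where \<tau> = "\<lambda>x. x"])
  show "kronecker S T * kron_fam (spec m \<pi>) (spec n \<rho>) x =
      kron_fam (spec m' \<pi>') (spec n' \<rho>') x * kronecker S T" for x
    using kronecker_mult[OF S(1) spec_carrier T(1) spec_carrier]
      kronecker_mult[OF spec_carrier S(1) spec_carrier T(1)]
      twist_rep_intertwine(1)[OF assms(1,3) S] twist_rep_intertwine(1)[OF assms(2,4) T]
    by (auto simp: kron_fam_def split: prod.split) metis
qed (use S T in \<open>auto simp: bij_id[unfolded id_def] intro!: kron_fam_carrier spec_carrier\<close>)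

text \<open>Evaluates the comparison unitary on a finer family than the spectra of its two factors,
  as is needed when a factor is itself a tensor product or the unit.\<close>

lemma twist_tensor_coarsening:
  assumes "coarsening m s (spec m \<pi>) E" "coarsening n t (spec n \<rho>) D"
    and "\<And>x. E x \<in> carrier_mat m m" "\<And>y. D y \<in> carrier_mat n n"
  shows "twist_tensor m \<pi> n \<rho> =
    lin_comb (m * n) (m * n) UNIV (\<lambda>(x, y). \<beta> (s x) (t y)) (kron_fam E D)"
  unfolding twist_tensor_def coarsening_calc[OF coarsening_kron_fam[OF assms]]
  by (simp add: case_prod_beta')

text \<open>All four factors are functions on one joint spectrum of triples of characters. Their
  products multiply pointwise, and the claim is the cocycle identity at each triple.\<close>

lemma twist_tensor_assoc:
  assumes \<pi>: "\<pi> \<in> hom G (unitary_group l)" and \<rho>: "\<rho> \<in> hom G (unitary_group m)"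
    and \<sigma>: "\<sigma> \<in> hom G (unitary_group n)"
  shows "twist_tensor (l * m) (\<lambda>g\<in>carrier G. kronecker (\<pi> g) (\<rho> g)) n \<sigma> *
      kronecker (twist_tensor l \<pi> m \<rho>) (1\<^sub>m n) =
    twist_tensor l \<pi> (m * n) (\<lambda>g\<in>carrier G. kronecker (\<rho> g) (\<sigma> g)) *
      kronecker (1\<^sub>m l) (twist_tensor m \<rho> n \<sigma>)"
proof -
  let ?E = "kron_fam (spec l \<pi>) (kron_fam (spec m \<rho>) (spec n \<sigma>))"
  let ?E' = "kron_fam (kron_fam (spec l \<pi>) (spec m \<rho>)) (spec n \<sigma>)"
  let ?N = "l * (m * n)"
  interpret resolution ?N ?E by (intro resolution_kron_fam spec_resolution \<pi> \<rho> \<sigma>)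
  note one = resolution.proj_total[OF spec_resolution, symmetric]
  \<comment> \<open>The two triple families consist of the same matrices since Kronecker products
    are strictly associative; only the bracketing of their index type differs.\<close>
  have reassoc: "lin_comb (l * m * n) (l * m * n) UNIV (\<lambda>((x, y), z). f x y z) ?E' =
      lin_comb ?N ?N UNIV (\<lambda>(x, y, z). f x y z) ?E" for f
  proof -
    have "bij (\<lambda>((x, y), z). (x, y, z))"
      by (rule o_bij[of "\<lambda>(x, y, z). ((x, y), z)"]) auto
    from lin_comb_reindex[OF this, of ?N ?N "\<lambda>(x, y, z). f x y z" ?E] show ?thesis
      by (simp add: case_prod_beta' kron_fam_def kronecker_assoc mult.assoc)
  qed
  have "twist_tensor (l * m) (\<lambda>g\<in>carrier G. kronecker (\<pi> g) (\<rho> g)) n \<sigma> =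
      lin_comb (l * m * n) (l * m * n) UNIV (\<lambda>((x, y), z). \<beta> (x + y) z) ?E'"
    by (subst twist_tensor_coarsening[OF spec_tensor[OF \<pi> \<rho>] coarsening_refl])
      (auto simp: case_prod_beta' intro: kron_fam_carrier spec_carrier)
  then have 1: "twist_tensor (l * m) (\<lambda>g\<in>carrier G. kronecker (\<pi> g) (\<rho> g)) n \<sigma> =
      lin_comb ?N ?N UNIV (\<lambda>(x, y, z). \<beta> (x + y) z) ?E"
    by (simp only: reassoc)
  have "kronecker (twist_tensor l \<pi> m \<rho>) (1\<^sub>m n) =
      lin_comb (l * m * n) (l * m * n) UNIV (\<lambda>((x, y), z). \<beta> x y) ?E'"
    unfolding twist_tensor_def one[OF \<sigma>]
    by (subst kronecker_lin_comb_fam) (auto simp: case_prod_beta' intro: kron_fam_carrier spec_carrier)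
  then have 2: "kronecker (twist_tensor l \<pi> m \<rho>) (1\<^sub>m n) =
      lin_comb ?N ?N UNIV (\<lambda>(x, y, z). \<beta> x y) ?E"
    by (simp only: reassoc)
  have 3: "twist_tensor l \<pi> (m * n) (\<lambda>g\<in>carrier G. kronecker (\<rho> g) (\<sigma> g)) =
      lin_comb ?N ?N UNIV (\<lambda>(x, y, z). \<beta> x (y + z)) ?E"
    by (subst twist_tensor_coarsening[OF coarsening_refl spec_tensor[OF \<rho> \<sigma>]])
      (auto simp: case_prod_beta' intro: kron_fam_carrier spec_carrier)
  have 4: "kronecker (1\<^sub>m l) (twist_tensor m \<rho> n \<sigma>) =
      lin_comb ?N ?N UNIV (\<lambda>(x, y, z). \<beta> y z) ?E"
    unfolding twist_tensor_def one[OF \<pi>]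
    by (subst kronecker_lin_comb_fam) (auto simp: case_prod_beta' intro: kron_fam_carrier spec_carrier)
  show ?thesis
    unfolding 1 2 3 4 calc_mult by (simp add: case_prod_beta' \<beta>_cocycle)
qed

lemma twist_tensor_unit:
  assumes \<pi>: "\<pi> \<in> hom G (unitary_group n)"
  shows "twist_tensor 1 (\<lambda>g\<in>carrier G. 1\<^sub>m 1) n \<pi> = 1\<^sub>m n"
    and "twist_tensor n \<pi> 1 (\<lambda>g\<in>carrier G. 1\<^sub>m 1) = 1\<^sub>m n"
proof -
  let ?u = "\<lambda>_::unit. 1\<^sub>m 1 :: complex mat"
  note res = spec_resolution[OF \<pi>]
  have "twist_tensor 1 (\<lambda>g\<in>carrier G. 1\<^sub>m 1) n \<pi> =
      lin_comb (1 * n) (1 * n) UNIV (\<lambda>_. 1) (kron_fam ?u (spec n \<pi>))"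
    by (subst twist_tensor_coarsening[OF spec_unit coarsening_refl])
      (auto simp: \<beta>_zero case_prod_beta' intro: spec_carrier)
  also have "\<dots> = 1\<^sub>m (1 * n)"
    by (rule resolution.proj_total[OF resolution_kron_fam[OF resolution_unit res]])
  finally show "twist_tensor 1 (\<lambda>g\<in>carrier G. 1\<^sub>m 1) n \<pi> = 1\<^sub>m n" by simp
  have "twist_tensor n \<pi> 1 (\<lambda>g\<in>carrier G. 1\<^sub>m 1) =
      lin_comb (n * 1) (n * 1) UNIV (\<lambda>_. 1) (kron_fam (spec n \<pi>) ?u)"
    by (subst twist_tensor_coarsening[OF coarsening_refl spec_unit])
      (auto simp: \<beta>_zero case_prod_beta' intro: spec_carrier)
  also have "\<dots> = 1\<^sub>m (n * 1)"
    by (rule resolution.proj_total[OF resolution_kron_fam[OF res resolution_unit]])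
  finally show "twist_tensor n \<pi> 1 (\<lambda>g\<in>carrier G. 1\<^sub>m 1) = 1\<^sub>m n" by simp
qed

end

section \<open>The twist as a unitary tensor functor\<close>

lemma Ball_Objs_Rep: "(\<forall>X\<in>Objs (Rep G). P X) \<longleftrightarrow>
    (\<forall>n. \<forall>\<pi>\<in>hom G (unitary_group n). \<pi> \<in> extensional (carrier G) \<longrightarrow> P (n, \<pi>))"
  by (auto simp: Rep_def)

lemma Ball_Mors_Rep: "(\<forall>T\<in>Mors (Rep G) (m, \<pi>) (n, \<rho>). P T) \<longleftrightarrow>
    (\<forall>T\<in>carrier_mat n m. (\<forall>g\<in>carrier G. T * \<pi> g = \<rho> g * T) \<longrightarrow> P T)"
  by (auto simp: Rep_def)

lemma unitary_mors_Rep: "T \<in> unitary_mors (Rep G) (n, \<pi>) (n, \<rho>) \<longleftrightarrow>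
    T \<in> carrier (unitary_group n) \<and> (\<forall>g\<in>carrier G. T * \<pi> g = \<rho> g * T)"
  by (auto simp: unitary_mors_def Rep_def unitary_group_def)

lemma one_unitary: "1\<^sub>m n \<in> carrier (unitary_group n)"
  by (simp add: unitary_group_def)

context twist
begin

lemma twist_functor_simps:
  "fun_obj twist_functor (n, \<pi>) = (n, twist_rep n \<pi>)" "fun_mor twist_functor X Y T = T"
  "fun_unit twist_functor = 1\<^sub>m 1" "fun_tensor twist_functor (m, \<pi>) (n, \<rho>) = twist_tensor m \<pi> n \<rho>"
  by (simp_all add: twist_functor_def)

lemma twist_rep_extensional: "twist_rep n \<pi> \<in> extensional (carrier H)"
  by (simp add: twist_rep_def)

lemma trivial_rep: "(\<lambda>g\<in>carrier G. 1\<^sub>m 1) \<in> hom G (unitary_group 1)"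
  by (rule homI) (auto simp: unitary_group_def)

text \<open>The image of the zero character is trivial on the conjugate of A by g, which is A again,
  and a character whose values over A sum to |A| must be zero.\<close>

lemma act_zero:
  assumes g: "g \<in> carrier G"
  shows "act g 0 = 0"
proof -
  have "e (act g 0) a = 1" if "a \<in> A" for a
  proof -
    have "a \<in> (\<lambda>b. g \<otimes> b \<otimes> inv g) ` A"
      using bij_betw_imp_surj_on[OF conj_bij[OF g]] that by simp
    then obtain b where "b \<in> A" "a = g \<otimes> b \<otimes> inv g" by blast
    then show ?thesis using e_act[OF g] by (simp add: e_zero)
  qed
  then have "(\<Sum>a\<in>A. e (act g 0) a) = of_nat (card A)" by simp
  then show ?thesis using e_sum[of "act g 0"] card_A by (auto split: if_splits)
qed

lemma twist_rep_unit:
  assumes h: "h \<in> carrier H"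
  shows "twist_rep 1 (\<lambda>g\<in>carrier G. 1\<^sub>m 1) h = 1\<^sub>m 1"
proof -
  \<comment> \<open>At the pair (0, 0) the compatibility of \<beta> and \<eta> says that \<eta> at 0
    equals its own square, and it has modulus one.\<close>
  have "\<eta> g 0 = 1" if "g \<in> carrier G" for g
    using \<beta>_\<eta>[OF that, of 0 0] \<eta>_norm[OF that, of 0] by (auto simp: \<beta>_zero act_zero[OF that])
  then have "calc 1 (\<lambda>g\<in>carrier G. 1\<^sub>m 1) (\<eta> (\<phi> h)) = 1\<^sub>m 1"
    unfolding coarsening_calc[OF spec_unit] using \<phi>_carrier[OF h] by (auto intro!: eq_matI)
  then show ?thesis
    using h \<phi>_carrier[OF h] by (simp add: twist_rep_def del: One_nat_def)
qed

lemma linear_star_twist_functor: "linear_star_functor (Rep G) (Rep H) twist_functor"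
  unfolding linear_star_functor_def Ball_Objs_Rep Ball_Mors_Rep twist_functor_simps Mors_Rep
  by (auto simp: Objs_Rep Rep_simps twist_rep_hom twist_rep_extensional twist_rep_intertwine)

lemma unitary_tensor_twist_functor: "unitary_tensor_functor (Rep G) (Rep H) twist_functor"
  unfolding unitary_tensor_functor_def
proof (intro conjI)
  show "linear_star_functor (Rep G) (Rep H) twist_functor" by (rule linear_star_twist_functor)
  show "fun_unit twist_functor \<in> unitary_mors (Rep H) (unit_obj (Rep H)) (fun_obj twist_functor (unit_obj (Rep G)))"
    by (simp add: Rep_simps twist_functor_simps unitary_mors_Rep one_unitary twist_rep_unit[simplified])
  show "\<forall>X\<in>Objs (Rep G). \<forall>Y\<in>Objs (Rep G).
      fun_tensor twist_functor X Y
        \<in> unitary_mors (Rep H) (tensor_obj (Rep H) (fun_obj twist_functor X) (fun_obj twist_functor Y))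
            (fun_obj twist_functor (tensor_obj (Rep G) X Y))"
    unfolding Ball_Objs_Rep Rep_simps twist_functor_simps unitary_mors_Rep
    by (simp add: twist_tensor_unitary twist_tensor_intertwine)
  show "\<forall>X\<in>Objs (Rep G). \<forall>Y\<in>Objs (Rep G). \<forall>X'\<in>Objs (Rep G). \<forall>Y'\<in>Objs (Rep G).
      \<forall>S\<in>Mors (Rep G) X X'. \<forall>T\<in>Mors (Rep G) Y Y'.
        comp_mor (Rep H)
          (fun_mor twist_functor (tensor_obj (Rep G) X Y) (tensor_obj (Rep G) X' Y') (tensor_mor (Rep G) S T))
          (fun_tensor twist_functor X Y) =
        comp_mor (Rep H) (fun_tensor twist_functor X' Y')
          (tensor_mor (Rep H) (fun_mor twist_functor X X' S) (fun_mor twist_functor Y Y' T))"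
    unfolding Ball_Objs_Rep Ball_Mors_Rep Rep_simps twist_functor_simps
    by (blast intro: twist_tensor_natural)
  show "\<forall>X\<in>Objs (Rep G). \<forall>Y\<in>Objs (Rep G). \<forall>Z\<in>Objs (Rep G).
      comp_mor (Rep H)
        (fun_mor twist_functor (tensor_obj (Rep G) (tensor_obj (Rep G) X Y) Z)
          (tensor_obj (Rep G) X (tensor_obj (Rep G) Y Z)) (associator (Rep G) X Y Z))
        (comp_mor (Rep H) (fun_tensor twist_functor (tensor_obj (Rep G) X Y) Z)
          (tensor_mor (Rep H) (fun_tensor twist_functor X Y) (id_mor (Rep H) (fun_obj twist_functor Z)))) =
      comp_mor (Rep H) (fun_tensor twist_functor X (tensor_obj (Rep G) Y Z))
        (comp_mor (Rep H)
          (tensor_mor (Rep H) (id_mor (Rep H) (fun_obj twist_functor X)) (fun_tensor twist_functor Y Z))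
          (associator (Rep H) (fun_obj twist_functor X) (fun_obj twist_functor Y) (fun_obj twist_functor Z)))"
    unfolding Ball_Objs_Rep Rep_simps twist_functor_simps
  proof (intro allI ballI impI)
    fix l \<pi> m \<rho> n \<sigma>
    assume "\<pi> \<in> hom G (unitary_group l)" "\<rho> \<in> hom G (unitary_group m)" "\<sigma> \<in> hom G (unitary_group n)"
    note assoc = twist_tensor_assoc[OF this]
    let ?L = "twist_tensor (l * m) (\<lambda>g\<in>carrier G. kronecker (\<pi> g) (\<rho> g)) n \<sigma> *
      kronecker (twist_tensor l \<pi> m \<rho>) (1\<^sub>m n)"
    \<comment> \<open>The associators are identity matrices of size \<open>l * m * n\<close>, while
      the factors next to them are built with size \<open>l * (m * n)\<close>. Once the sizes are
      matched, the identities cancel.\<close>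
    have "?L \<in> carrier_mat (l * m * n) (l * m * n)"
      and "kronecker (1\<^sub>m l) (twist_tensor m \<rho> n \<sigma>) \<in> carrier_mat (l * m * n) (l * m * n)"
      unfolding carrier_mat_def by (simp_all add: twist_tensor_def)
    then show "1\<^sub>m (l * m * n) * ?L =
      twist_tensor l \<pi> (m * n) (\<lambda>g\<in>carrier G. kronecker (\<rho> g) (\<sigma> g)) *
        (kronecker (1\<^sub>m l) (twist_tensor m \<rho> n \<sigma>) * 1\<^sub>m (l * m * n))"
      using left_mult_one_mat[of ?L "l * m * n" "l * m * n"]
        right_mult_one_mat[of "kronecker (1\<^sub>m l) (twist_tensor m \<rho> n \<sigma>)" "l * m * n" "l * m * n"]
      by (simp only: assoc)
  qed
  show "\<forall>X\<in>Objs (Rep G).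
      comp_mor (Rep H) (fun_mor twist_functor (tensor_obj (Rep G) (unit_obj (Rep G)) X) X (left_unitor (Rep G) X))
        (comp_mor (Rep H) (fun_tensor twist_functor (unit_obj (Rep G)) X)
          (tensor_mor (Rep H) (fun_unit twist_functor) (id_mor (Rep H) (fun_obj twist_functor X)))) =
      left_unitor (Rep H) (fun_obj twist_functor X)"
    unfolding Ball_Objs_Rep Rep_simps twist_functor_simps by (simp add: twist_tensor_unit[simplified])
  show "\<forall>X\<in>Objs (Rep G).
      comp_mor (Rep H) (fun_mor twist_functor (tensor_obj (Rep G) X (unit_obj (Rep G))) X (right_unitor (Rep G) X))
        (comp_mor (Rep H) (fun_tensor twist_functor X (unit_obj (Rep G)))
          (tensor_mor (Rep H) (id_mor (Rep H) (fun_obj twist_functor X)) (fun_unit twist_functor))) =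
      right_unitor (Rep H) (fun_obj twist_functor X)"
    unfolding Ball_Objs_Rep Rep_simps twist_functor_simps by (simp add: twist_tensor_unit[simplified])
qed

end

text \<open>
  Twisting back by the inverse cocycle undoes the functor strictly, so both natural isomorphisms
  are given by identity matrices.
\<close>

lemma twist_inverse:
  fixes \<phi> :: "'h \<Rightarrow> 'g" and \<psi> :: "'g \<Rightarrow> 'h"
  assumes "twist G A e H \<phi> act \<eta> \<beta>" "twist H B e' G \<psi> act' \<eta>' \<beta>'"
    and inverse: "\<And>g. g \<in> carrier G \<Longrightarrow> \<phi> (\<psi> g) = g"
    and bij: "bij_betw \<phi> B A"
    and e: "\<And>\<chi> b. b \<in> B \<Longrightarrow> e' \<chi> b = e \<chi> (\<phi> b)"
    and \<eta>_A: "\<And>\<chi> a. a \<in> A \<Longrightarrow> \<eta> a \<chi> = 1"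
    and \<eta>': "\<And>\<chi> g. g \<in> carrier G \<Longrightarrow> \<eta>' (\<psi> g) \<chi> = cnj (\<eta> g \<chi>)"
    and \<beta>': "\<And>\<chi> \<omega>. \<beta>' \<chi> \<omega> = cnj (\<beta> \<chi> \<omega>)"
  shows "unitary_monoidal_nat_iso (Rep G) (Rep G)
    (comp_tensor_functor (Rep G) (Rep H) (Rep G) (twist.twist_functor B e' G \<psi> \<eta>' \<beta>')
      (twist.twist_functor A e H \<phi> \<eta> \<beta>))
    (id_tensor_functor (Rep G)) (id_mor (Rep G))"
proof -
  interpret F: twist G A e H \<phi> act \<eta> \<beta> by fact
  interpret F': twist H B e' G \<psi> act' \<eta>' \<beta>' by fact
  \<comment> \<open>Since \<eta> is trivial on A, twisting does not change the restriction to A. The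
    second functor therefore uses the projections of the original representation, and its phases can
    cancel those of the first.\<close>
  have spec: "F'.spec n (F.twist_rep n \<pi>) \<chi> = F.spec n \<pi> \<chi>" if \<pi>: "\<pi> \<in> hom G (unitary_group n)" for n \<pi> \<chi>
  proof -
    have B: "F.twist_rep n \<pi> b = \<pi> (\<phi> b)" if b: "b \<in> B" for b
    proof -
      have "\<phi> b \<in> A" using b bij by (auto simp: bij_betw_def)
      then have "\<eta> (\<phi> b) = (\<lambda>_. 1)" by (simp add: \<eta>_A fun_eq_iff)
      with \<open>\<phi> b \<in> A\<close> show ?thesis
        using b F'.A_carrier F.rep_props(2)[OF \<pi> F.A_carrier[OF \<open>\<phi> b \<in> A\<close>]] resolution.proj_total[OF F.spec_resolution[OF \<pi>]]
        by (simp add: F.twist_rep_def)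
    qed
    have "F'.spec n (F.twist_rep n \<pi>) \<chi> =
        lin_comb n n B (\<lambda>b. cnj (e \<chi> (\<phi> b)) / of_nat (card A)) (\<lambda>b. \<pi> (\<phi> b))"
      unfolding F'.spec_def using B e bij_betw_same_card[OF bij] by (intro lin_comb_cong) auto
    also have "\<dots> = F.spec n \<pi> \<chi>"
      unfolding F.spec_def by (rule lin_comb_reindex[OF bij])
    finally show ?thesis .
  qed
  have rep: "F'.twist_rep n (F.twist_rep n \<pi>) = \<pi>"
    if \<pi>: "\<pi> \<in> hom G (unitary_group n)" and ext: "\<pi> \<in> extensional (carrier G)" for n \<pi>
  proof (rule extensionalityI[OF F'.twist_rep_extensional ext])
    fix g assume g: "g \<in> carrier G"
    interpret resolution n "F.spec n \<pi>" by (rule F.spec_resolution[OF \<pi>])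
    note C = F.rep_props(2)[OF \<pi> g]
    have "F.twist_rep n \<pi> (\<psi> g) = \<pi> g * F.calc n \<pi> (\<eta> g)"
      using g F'.\<phi>_carrier[OF g] by (simp add: F.twist_rep_def inverse)
    then have "F'.twist_rep n (F.twist_rep n \<pi>) g =
        \<pi> g * F.calc n \<pi> (\<eta> g) * F.calc n \<pi> (\<lambda>\<chi>. cnj (\<eta> g \<chi>))"
      using g by (simp add: F'.twist_rep_def spec[OF \<pi>] \<eta>' cong: lin_comb_cong)
    also have "\<dots> = \<pi> g"
      using g C F.\<eta>_norm[OF g] proj_total
      by (simp add: assoc_mult_mat[OF C lin_comb_carrier lin_comb_carrier] calc_mult mult.commute)
    finally show "F'.twist_rep n (F.twist_rep n \<pi>) g = \<pi> g" .
  qed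
  \<comment> \<open>On the common joint spectrum the two comparison unitaries are \<beta> and its
    conjugate, whose product is 1 by \<open>\<beta>_norm\<close>.\<close>
  have tensor: "F.twist_tensor m \<pi> n \<rho> * F'.twist_tensor m (F.twist_rep m \<pi>) n (F.twist_rep n \<rho>) = 1\<^sub>m (m * n)"
    if \<pi>: "\<pi> \<in> hom G (unitary_group m)" and \<rho>: "\<rho> \<in> hom G (unitary_group n)" for m \<pi> n \<rho>
  proof -
    interpret resolution "m * n" "kron_fam (F.spec m \<pi>) (F.spec n \<rho>)"
      by (rule F.kron_spec_resolution[OF \<pi> \<rho>])
    have "kron_fam (F'.spec m (F.twist_rep m \<pi>)) (F'.spec n (F.twist_rep n \<rho>)) = kron_fam (F.spec m \<pi>) (F.spec n \<rho>)"
      by (simp add: kron_fam_def spec[OF \<pi>] spec[OF \<rho>])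
    then show ?thesis
      using F.\<beta>_norm proj_total
      by (simp add: F.twist_tensor_def F'.twist_tensor_def calc_mult case_prod_beta' \<beta>' mult.commute)
  qed
  show ?thesis
    unfolding unitary_monoidal_nat_iso_def Ball_Objs_Rep
      comp_tensor_functor_def id_tensor_functor_def tensor_functor.simps
    by (auto simp: Rep_simps F.twist_functor_simps F'.twist_functor_simps Ball_Mors_Rep
        unitary_mors_Rep one_unitary rep tensor F.trivial_rep
        intro: left_mult_one_mat right_mult_one_mat dest: F.rep_props(2)[rotated 1])
qed

text \<open>Both composites are handled by \<open>twist_inverse\<close> with the roles of G and H
  exchanged. The compatibility of the data is assumed from one side; the mirror conditions follow
  since \<phi> and \<psi> are mutually inverse.\<close>

theorem twist_monoidally_equivalent:
  fixes \<phi> :: "'h \<Rightarrow> 'g" and \<psi> :: "'g \<Rightarrow> 'h"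
  assumes F: "twist G A e H \<phi> act \<eta> \<beta>" and F': "twist H B e' G \<psi> act' \<eta>' \<beta>'"
    and \<phi>\<psi>: "\<And>g. g \<in> carrier G \<Longrightarrow> \<phi> (\<psi> g) = g" and \<psi>\<phi>: "\<And>h. h \<in> carrier H \<Longrightarrow> \<psi> (\<phi> h) = h"
    and \<phi>_B: "\<And>b. b \<in> B \<Longrightarrow> \<phi> b \<in> A" and \<psi>_A: "\<And>a. a \<in> A \<Longrightarrow> \<psi> a \<in> B"
    and e: "\<And>\<chi> b. b \<in> B \<Longrightarrow> e' \<chi> b = e \<chi> (\<phi> b)"
    and \<eta>_A: "\<And>\<chi> a. a \<in> A \<Longrightarrow> \<eta> a \<chi> = 1"
    and \<eta>': "\<And>\<chi> g. g \<in> carrier G \<Longrightarrow> \<eta>' (\<psi> g) \<chi> = cnj (\<eta> g \<chi>)"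
    and \<beta>': "\<And>\<chi> \<omega>. \<beta>' \<chi> \<omega> = cnj (\<beta> \<chi> \<omega>)"
  shows "monoidally_equivalent G H"
proof -
  interpret F: twist G A e H \<phi> act \<eta> \<beta> by fact
  interpret F': twist H B e' G \<psi> act' \<eta>' \<beta>' by fact
  have A: "a \<in> carrier G" if "a \<in> A" for a using that by simp
  have B: "b \<in> carrier H" if "b \<in> B" for b using that by simp
  have bij: "bij_betw \<phi> B A" "bij_betw \<psi> A B"
    using \<phi>\<psi> \<psi>\<phi> \<phi>_B \<psi>_A A B by (auto intro: bij_betwI[where g = \<psi>] bij_betwI[where g = \<phi>])
  have "unitary_monoidal_nat_iso (Rep G) (Rep G)
      (comp_tensor_functor (Rep G) (Rep H) (Rep G) F'.twist_functor F.twist_functor)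
      (id_tensor_functor (Rep G)) (id_mor (Rep G))"
    by (rule twist_inverse[OF F F' \<phi>\<psi> bij(1) e \<eta>_A \<eta>' \<beta>'])
  moreover have "unitary_monoidal_nat_iso (Rep H) (Rep H)
      (comp_tensor_functor (Rep H) (Rep G) (Rep H) F.twist_functor F'.twist_functor)
      (id_tensor_functor (Rep H)) (id_mor (Rep H))"
  proof (rule twist_inverse[OF F' F \<psi>\<phi> bij(2)])
    show "e \<chi> a = e' \<chi> (\<psi> a)" if "a \<in> A" for \<chi> a using that e[OF \<psi>_A[OF that]] \<phi>\<psi> A by simp
    show "\<eta>' b \<chi> = 1" if "b \<in> B" for \<chi> b
      using \<eta>'[OF F.A_carrier[OF \<phi>_B[OF that]], of \<chi>] \<eta>_A[OF \<phi>_B[OF that], of \<chi>] \<psi>\<phi>[OF B[OF that]] by simp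
    show "\<eta> (\<phi> h) \<chi> = cnj (\<eta>' h \<chi>)" if "h \<in> carrier H" for \<chi> h
      using \<eta>'[OF F.\<phi>_carrier[OF that], of \<chi>] \<psi>\<phi>[OF that] by simp
    show "\<beta> \<chi> \<omega> = cnj (\<beta>' \<chi> \<omega>)" for \<chi> \<omega> using \<beta>' by simp
  qed
  ultimately show ?thesis
    unfolding monoidally_equivalent_def unitarily_monoidally_equivalent_def
    using F.unitary_tensor_twist_functor F'.unitary_tensor_twist_functor by blast
qed

section \<open>Arithmetic and characters of Z/4\<close>

lemma four_cases: "(x::4) = 0 \<or> x = 1 \<or> x = 2 \<or> x = 3"
proof (cases x)
  case (of_int z)
  then have "z = 0 \<or> z = 1 \<or> z = 2 \<or> z = 3" by auto
  with of_int show ?thesis by auto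
qed

lemma four_UNIV: "(UNIV :: 4 set) = {0, 1, 2, 3}"
  using four_cases by auto

lemma four_numerals: "(4::4) = 0" "(5::4) = 1" "(6::4) = 2" "- (1::4) = 3"
  by simp_all

lemma four_double: "2 * x + 2 * x = (0::4)" "2 * x + (2 * x + y) = (y::4)"
  using four_cases[of x] by auto

text \<open>The faithful character sending x to the x-th power of \<i>, written by cases because x
  lives in Z/4. All scalars of the twist are values of it, so their identities become polynomial
  identities modulo 4 in the exponents.\<close>

definition chi :: "4 \<Rightarrow> complex" where
  "chi x = (if x = 0 then 1 else if x = 1 then \<i> else if x = 2 then - 1 else - \<i>)"

lemma chi_zero [simp]: "chi 0 = 1"
  by (simp add: chi_def)

lemma chi_add: "chi (x + y) = chi x * chi y"
  using four_cases[of x] four_cases[of y] by (elim disjE) (simp_all add: chi_def)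

lemma chi_norm: "cnj (chi x) * chi x = 1"
  by (simp add: chi_def)

lemma chi_minus: "chi (- x) = cnj (chi x)"
proof -
  have "chi (- x) * chi x = cnj (chi x) * chi x"
    unfolding chi_norm chi_add[symmetric] by simp
  moreover have "chi x \<noteq> 0" using chi_norm[of x] by auto
  ultimately show ?thesis by simp
qed

lemma chi_sum: "(\<Sum>x\<in>UNIV. chi (y * x)) = of_bool (y = 0) * 4"
  unfolding four_UNIV using four_cases[of y] by (elim disjE) (simp_all add: chi_def)

lemma sum_plane:
  fixes f g :: "4 \<Rightarrow> 'a::comm_semiring_0"
  shows "(\<Sum>(a, b)\<in>UNIV. f a * g b) = (\<Sum>a\<in>UNIV. f a) * (\<Sum>b\<in>UNIV. g b)"
  by (simp add: sum_product sum.cartesian_product flip: UNIV_Times_UNIV)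

subsection \<open>The Izumi--Kosaki group and its twist in coordinates\<close>

text \<open>
  The element \<open>(a, b, p, q)\<close> stands for the translation by \<open>(a, b)\<close> times \<open>h\<^sub>1\<^sup>p h\<^sub>2\<^sup>q\<close>. For
  \<open>\<epsilon> = False\<close> this is the Izumi--Kosaki group; for \<open>\<epsilon> = True\<close> the lifts of \<open>h\<^sub>1\<close> and \<open>h\<^sub>2\<close>
  square to \<open>(2, 0)\<close> and \<open>(0, 2)\<close>.
\<close>

type_synonym coord = "4 \<times> 4 \<times> bool \<times> bool"

fun ik_mult :: "bool \<Rightarrow> coord \<Rightarrow> coord \<Rightarrow> coord" where
  "ik_mult \<epsilon> (a, b, p, q) (c, d, r, s) =
     (a + c + 2 * of_bool p * d + 2 * of_bool (\<epsilon> \<and> p \<and> r),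
      b + d + 2 * of_bool q * c + 2 * of_bool (\<epsilon> \<and> q \<and> s), p \<noteq> r, q \<noteq> s)"

lemma ik_mult_one: "ik_mult \<epsilon> x (0, 0, False, False) = x" "ik_mult \<epsilon> (0, 0, False, False) x = x"
  by (cases x; simp)+

lemma ik_mult_idem: "ik_mult \<epsilon> x x = x \<Longrightarrow> x = (0, 0, False, False)"
  by (cases x) auto

text \<open>A group of any type with a multiplicative coordinate system. Orders, the twist and the
  comparison of groups are settled at this level, so each presentation is inspected just once, to
  produce coordinates.\<close>

locale ik_coords = group G for G (structure) +
  fixes \<epsilon> :: bool and c :: "'a \<Rightarrow> coord"
  assumes c_bij: "bij_betw c (carrier G) UNIV"
    and c_mult: "x \<in> carrier G \<Longrightarrow> y \<in> carrier G \<Longrightarrow> c (x \<otimes> y) = ik_mult \<epsilon> (c x) (c y)"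
begin

lemma c_one: "c \<one> = (0, 0, False, False)"
  using c_mult[of \<one> \<one>] by (intro ik_mult_idem[of \<epsilon>]) simp

lemma c_eq_iff: "x \<in> carrier G \<Longrightarrow> y \<in> carrier G \<Longrightarrow> c x = c y \<longleftrightarrow> x = y"
  using c_bij by (auto simp: bij_betw_def inj_on_def)

definition elt :: "coord \<Rightarrow> 'a" where
  "elt = the_inv_into (carrier G) c"

lemma elt: "elt x \<in> carrier G" "c (elt x) = x" "g \<in> carrier G \<Longrightarrow> elt (c g) = g"
  using c_bij by (auto simp: elt_def bij_betw_def f_the_inv_into_f the_inv_into_f_f
      intro!: the_inv_into_into[of c "carrier G" x "carrier G"])

definition plane :: "'a set" where
  "plane = {g \<in> carrier G. \<exists>a b. c g = (a, b, False, False)}"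

definition pairing :: "4 \<times> 4 \<Rightarrow> 'a \<Rightarrow> complex" where
  "pairing = (\<lambda>(j, k) g. case c g of (a, b, p, q) \<Rightarrow> chi (j * a + k * b))"

text \<open>The contragredient action: the matrix with off-diagonal entries 2p and 2q is its own
  inverse modulo 4, so the inverse transpose is just the transpose.\<close>

definition dual_act :: "'a \<Rightarrow> 4 \<times> 4 \<Rightarrow> 4 \<times> 4" where
  "dual_act g = (\<lambda>(j, k). case c g of (a, b, p, q) \<Rightarrow> (j + 2 * of_bool q * k, k + 2 * of_bool p * j))"

text \<open>The exponent is s times a quadratic form with polarization 2(pjl + qkm), which is the
  amount by which the dual action changes jm modulo 4. The sign s will select the cocycle or its
  conjugate.\<close>

definition phase :: "4 \<Rightarrow> 'a \<Rightarrow> 4 \<times> 4 \<Rightarrow> complex" where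
  "phase s g = (\<lambda>(j, k). case c g of (a, b, p, q) \<Rightarrow> chi (s * (of_bool p * j * j + of_bool q * k * k)))"

lemma plane_bij: "bij_betw (\<lambda>(a, b). elt (a, b, False, False)) UNIV plane"
  by (rule bij_betwI[where g = "\<lambda>g. (fst (c g), fst (snd (c g)))"])
    (auto simp: plane_def elt, metis elt(3))

lemma card_plane: "card plane = 16"
  using bij_betw_same_card[OF plane_bij] by (simp add: card_UNIV_option)

lemma planeE:
  assumes "g \<in> plane"
  obtains a b where "g \<in> carrier G" "c g = (a, b, False, False)"
  using assms by (auto simp: plane_def)

lemma c_conj:
  assumes g: "g \<in> carrier G" "c g = (u, v, p, q)" and x: "x \<in> carrier G" "c x = (a, b, False, False)"
  shows "c (g \<otimes> x \<otimes> inv g) = (a + 2 * of_bool p * b, b + 2 * of_bool q * a, False, False)"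
proof -
  obtain w z r s where y: "c (g \<otimes> x \<otimes> inv g) = (w, z, r, s)" by (metis prod_cases4)
  \<comment> \<open>Multiplying back by g avoids coordinates of the inverse. As x has no matrix
    part, no correction depending on \<epsilon> arises on either side.\<close>
  have "g \<otimes> x \<otimes> inv g \<otimes> g = g \<otimes> x" using g x by (simp add: m_assoc)
  then have "ik_mult \<epsilon> (w, z, r, s) (u, v, p, q) = ik_mult \<epsilon> (u, v, p, q) (a, b, False, False)"
    using g x y by (metis c_mult inv_closed m_closed)
  moreover from this have "\<not> r" "\<not> s" by auto
  ultimately show ?thesis unfolding y by (auto simp: add_ac)
qed

lemma dual_pair_plane: "dual_pair G plane pairing"
proof (intro dual_pair.intro dual_pair_axioms.intro)
  show "group G" by (rule is_group)
  have one: "\<one> \<in> plane" by (simp add: plane_def c_one)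
  have mult: "x \<otimes> y \<in> plane" if "x \<in> plane" "y \<in> plane" for x y
    using that by (auto elim!: planeE simp: plane_def c_mult)
  have fin: "finite plane" using card_plane by (intro card_ge_0_finite) simp
  show "finite plane" by fact
  show "subgroup plane G"
  proof (rule subgroupI)
    show "inv x \<in> plane" if x_plane: "x \<in> plane" for x
    proof -
      obtain a b where x: "x \<in> carrier G" "c x = (a, b, False, False)" using x_plane by (rule planeE)
      obtain w z r s where y: "c (inv x) = (w, z, r, s)" by (metis prod_cases4)
      have "ik_mult \<epsilon> (w, z, r, s) (a, b, False, False) = (0, 0, False, False)"
        using x c_mult[of "inv x" x] by (simp add: y c_one del: ik_mult.simps)
      then show ?thesis using x y by (auto simp: plane_def)
    qed
  qed (use one mult in \<open>auto simp: plane_def\<close>)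
  show "pairing (\<chi> + \<psi>) a = pairing \<chi> a * pairing \<psi> a" for \<chi> \<psi> a
    by (auto simp: pairing_def algebra_simps simp flip: chi_add split: prod.split)
  show "pairing \<chi> (a \<otimes> b) = pairing \<chi> a * pairing \<chi> b" if "a \<in> plane" "b \<in> plane" for \<chi> a b
    using that by (auto elim!: planeE simp: pairing_def c_mult algebra_simps simp flip: chi_add split: prod.split)
  show "cnj (pairing \<chi> a) * pairing \<chi> a = 1" for \<chi> a
    by (auto simp: pairing_def chi_norm split: prod.split)
  show "(\<Sum>a\<in>plane. pairing \<chi> a) = of_bool (\<chi> = 0) * of_nat (card plane)" for \<chi>
  proof -
    obtain j k where \<chi>: "\<chi> = (j, k)" by (cases \<chi>)
    have "(\<Sum>a\<in>plane. pairing \<chi> a) = (\<Sum>(a, b)\<in>UNIV. chi (j * a) * chi (k * b))"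
      by (subst sum.reindex_bij_betw[OF plane_bij, symmetric])
        (simp add: \<chi> pairing_def elt case_prod_beta' chi_add)
    then show ?thesis unfolding sum_plane chi_sum by (auto simp: \<chi> card_plane zero_prod_def)
  qed
  show "(\<Sum>\<chi>\<in>UNIV. pairing \<chi> x) = of_bool (x = \<one>) * of_nat (card plane)" if x_plane: "x \<in> plane" for x
  proof -
    obtain a b where x: "x \<in> carrier G" "c x = (a, b, False, False)" using x_plane by (rule planeE)
    have "(\<Sum>\<chi>\<in>UNIV. pairing \<chi> x) = (\<Sum>(j, k)\<in>UNIV. chi (a * j) * chi (b * k))"
      by (simp add: x pairing_def case_prod_beta' chi_add mult.commute)
    moreover have "x = \<one> \<longleftrightarrow> a = 0 \<and> b = 0"
      using c_eq_iff[OF x(1) one_closed] by (simp add: x c_one)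
    ultimately show ?thesis unfolding sum_plane chi_sum by (auto simp: card_plane)
  qed
qed

end

text \<open>Exponent identities, with the terms that vanish in Z/4 displayed as multiples of 4. In
  order they give: invariance of \<beta> up to the phase, invariance of the pairing, composition of
  phases, and involutivity of the dual action. P and Q stand for the bits of the matrix
  part.\<close>

lemma twist_identities:
  fixes j k l m a b s P Q P' Q' :: "'a::comm_ring_1"
  shows "s * (j + 2 * Q * k) * (m + 2 * P * l) + (s * (P * j * j + Q * k * k) + s * (P * l * l + Q * m * m)) =
      s * (P * (j + l) * (j + l) + Q * (k + m) * (k + m)) + s * j * m + 4 * (s * P * Q * k * l)"
    and "(j + 2 * Q * k) * (a + 2 * P * b) + (k + 2 * P * j) * (b + 2 * Q * a) =
      j * a + k * b + 4 * (P * j * b + Q * k * a + P * Q * k * b + P * Q * j * a)"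
    and "s * (P' * (j + 2 * Q * k) * (j + 2 * Q * k) + Q' * (k + 2 * P * j) * (k + 2 * P * j)) +
        s * (P * j * j + Q * k * k) =
      s * (P + P') * j * j + s * (Q + Q') * k * k +
      4 * (s * (P' * (Q * j * k + Q * Q * k * k) + Q' * (P * j * k + P * P * j * j)))"
    and "j + 2 * Q * k + 2 * Q * (k + 2 * P * j) = j + 4 * (Q * k + Q * P * j)"
  by (simp_all add: algebra_simps)

text \<open>x and x^2 have the same parity, so 2x = 2x^2 = -2x^2 modulo 4, while the sum of two bits
  is their exclusive or plus twice their conjunction. This turns the carry of the quadratic phase
  into a linear term, that is, into an element of A.\<close>

lemma double_square:
  assumes "s = 1 \<or> s = - (1::4)"
  shows "x * (2 * of_bool (p \<and> q)) + s * of_bool (p \<noteq> q) * x * x = s * (of_bool p + of_bool q) * x * x"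
proof -
  have "x * 2 = s * 2 * x * x"
    using assms four_cases[of x] by (elim disjE) simp_all
  then show ?thesis by (cases p; cases q) simp_all
qed

context ik_coords
begin

lemma elt_mult: "elt x \<otimes> elt y = elt (ik_mult \<epsilon> x y)"
  using elt(3)[of "elt x \<otimes> elt y"] by (simp add: elt c_mult)

lemma dual_act_bij: "bij (dual_act g)"
proof -
  obtain u v p q where "c g = (u, v, p, q)" by (metis prod_cases4)
  then have "dual_act g (dual_act g \<chi>) = \<chi>" for \<chi>
    by (cases \<chi>) (simp add: dual_act_def twist_identities(4) four_numerals(1))
  then show ?thesis by (intro o_bij[of "dual_act g"]) (auto simp: fun_eq_iff)
qed

lemma ik_twist:
  assumes H: "ik_coords H (\<not> \<epsilon>) d" and s: "s = 1 \<or> s = - 1"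
  shows "twist G plane pairing H (\<lambda>h. elt (d h)) dual_act (phase s) (\<lambda>(j, k) (j', k'). chi (s * j * k'))"
proof -
  interpret H: ik_coords H "\<not> \<epsilon>" d by fact
  interpret dual_pair G plane pairing by (rule dual_pair_plane)
  let ?\<beta> = "\<lambda>(j, k) (j', k'). chi (s * j * k')"
  show ?thesis
  proof
    fix \<chi> \<psi> \<omega> :: "4 \<times> 4"
    obtain j k where \<chi>: "\<chi> = (j, k)" by (cases \<chi>)
    obtain l m where \<psi>: "\<psi> = (l, m)" by (cases \<psi>)
    show "cnj (phase s g \<chi>) * phase s g \<chi> = 1" for g
      by (simp add: phase_def \<chi> chi_norm split: prod.split)
    show "cnj (?\<beta> \<chi> \<psi>) * ?\<beta> \<chi> \<psi> = 1"
      by (simp add: \<chi> \<psi> chi_norm)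
    show "?\<beta> (\<chi> + \<psi>) \<omega> * ?\<beta> \<chi> \<psi> = ?\<beta> \<chi> (\<psi> + \<omega>) * ?\<beta> \<psi> \<omega>"
      by (cases \<omega>) (simp add: \<chi> \<psi> algebra_simps flip: chi_add)
    show "?\<beta> 0 \<chi> = 1" "?\<beta> \<chi> 0 = 1"
      by (simp_all add: \<chi> zero_prod_def)
    show "?\<beta> (dual_act g \<chi>) (dual_act g \<psi>) * (phase s g \<chi> * phase s g \<psi>) = phase s g (\<chi> + \<psi>) * ?\<beta> \<chi> \<psi>"
      for g
    proof -
      obtain u v p q where "c g = (u, v, p, q)" by (metis prod_cases4)
      then show ?thesis
        by (simp add: dual_act_def phase_def \<chi> \<psi> twist_identities(1) four_numerals(1) flip: chi_add)
    qed
  next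
    fix g a and \<chi> :: "4 \<times> 4" assume g: "g \<in> carrier G" and "a \<in> plane"
    then obtain w z where a: "a \<in> carrier G" "c a = (w, z, False, False)" by (blast elim: planeE)
    obtain u v p q where c: "c g = (u, v, p, q)" by (metis prod_cases4)
    show "g \<otimes> a \<otimes> inv g \<in> plane"
      unfolding plane_def using g a(1) c_conj[OF g c a] by blast
    show "pairing (dual_act g \<chi>) (g \<otimes> a \<otimes> inv g) = pairing \<chi> a"
      by (cases \<chi>) (simp add: pairing_def dual_act_def c a c_conj[OF g c a] twist_identities(2) four_numerals(1))
  next
    fix h h' assume h: "h \<in> carrier H" "h' \<in> carrier H"
    obtain u v p q where d: "d h = (u, v, p, q)" by (metis prod_cases4)
    obtain u' v' p' q' where d': "d h' = (u', v', p', q')" by (metis prod_cases4)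
    \<comment> \<open>The defect between the two multiplications. It lies in 2A, hence is central,
      and twice it is zero, so the same element leads from either multiplication to the
      other.\<close>
    let ?b = "(2 * of_bool (p \<and> p'), 2 * of_bool (q \<and> q'), False, False)"
    have "ik_mult (\<not> \<epsilon>) (d h) (d h') = ik_mult \<epsilon> (ik_mult \<epsilon> (d h) (d h')) ?b"
      unfolding d d' by (cases \<epsilon>; cases p; cases q; cases p'; cases q') (simp_all add: four_double add_ac)
    then have 1: "elt (d (h \<otimes>\<^bsub>H\<^esub> h')) = elt (d h) \<otimes> elt (d h') \<otimes> elt ?b"
      by (simp only: elt_mult H.c_mult[OF h])
    have b_plane: "elt ?b \<in> plane" unfolding plane_def using elt(1,2) by blast
    have 2: "pairing \<chi> (elt ?b) * phase s (elt (d (h \<otimes>\<^bsub>H\<^esub> h'))) \<chi> =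
        phase s (elt (d h)) (dual_act (elt (d h')) \<chi>) * phase s (elt (d h')) \<chi>" for \<chi> :: "4 \<times> 4"
    proof -
      obtain j k where \<chi>: "\<chi> = (j, k)" by (cases \<chi>)
      have "j * (2 * of_bool (p \<and> p')) + k * (2 * of_bool (q \<and> q')) +
          s * (of_bool (p \<noteq> p') * j * j + of_bool (q \<noteq> q') * k * k) =
          s * (of_bool p' + of_bool p) * j * j + s * (of_bool q' + of_bool q) * k * k"
        unfolding add.commute[of "of_bool p'" "of_bool p"] add.commute[of "of_bool q'" "of_bool q"]
          double_square[OF s, symmetric]
        by (simp only: distrib_left mult.assoc add_ac)
      then show ?thesis
        by (simp add: \<chi> pairing_def phase_def dual_act_def elt H.c_mult[OF h] d d'
            twist_identities(3) four_numerals(1) del: of_bool_conj of_bool_eq_iff flip: chi_add)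
    qed
    show "\<exists>b\<in>plane. elt (d (h \<otimes>\<^bsub>H\<^esub> h')) = elt (d h) \<otimes> elt (d h') \<otimes> b \<and>
        (\<forall>\<chi>. pairing \<chi> b * phase s (elt (d (h \<otimes>\<^bsub>H\<^esub> h'))) \<chi> =
          phase s (elt (d h)) (dual_act (elt (d h')) \<chi>) * phase s (elt (d h')) \<chi>)"
      using 1 2 b_plane by blast
  qed (auto simp: elt dual_act_bij intro: H.is_group)
qed

end

theorem ik_coords_monoidally_equivalent:
  assumes "ik_coords G \<epsilon> c" "ik_coords H (\<not> \<epsilon>) d"
  shows "monoidally_equivalent G H"
proof -
  interpret G: ik_coords G \<epsilon> c by fact
  interpret H: ik_coords H "\<not> \<epsilon>" d by fact
  have "ik_coords G (\<not> \<not> \<epsilon>) c" using assms(1) by simp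
  \<comment> \<open>Conjugating a power of \<i> changes the sign of its exponent, so the inverse
    data are those with s = -1.\<close>
  from G.ik_twist[OF assms(2), of 1] H.ik_twist[OF this, of "- 1"] show ?thesis
  proof (rule twist_monoidally_equivalent)
    show "H.phase (- 1) (H.elt (c g)) \<chi> = cnj (G.phase 1 g \<chi>)" for g \<chi>
      by (auto simp: G.phase_def H.phase_def H.elt simp flip: chi_minus split: prod.split)
    show "(case \<chi> of (j, k) \<Rightarrow> \<lambda>(j', k'). chi (- 1 * j * k')) \<omega> =
        cnj ((case \<chi> of (j, k) \<Rightarrow> \<lambda>(j', k'). chi (1 * j * k')) \<omega>)" for \<chi> \<omega>
      by (auto simp flip: chi_minus split: prod.split)
    show "G.phase 1 a \<chi> = 1" if "a \<in> G.plane" for a \<chi>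
      using that by (cases \<chi>) (auto simp: G.plane_def G.phase_def)
  qed (auto simp: G.elt H.elt G.plane_def H.plane_def G.pairing_def H.pairing_def)
qed

subsection \<open>Presented groups\<close>

definition word_class :: "('g word \<times> 'g word) set \<Rightarrow> 'g word \<Rightarrow> 'g word set" where
  "word_class R w = {v. word_eq R w v}"

lemma word_eq_append:
  assumes "word_eq R u v"
  shows "word_eq R (a @ u @ b) (a @ v @ b)"
  using assms
proof (induction rule: word_eq.induct)
  case (word_cancel u x c v)
  show ?case using word_eq.word_cancel[of R "a @ u" x c "v @ b"] by simp
next
  case (word_rel l r u v)
  then show ?case using word_eq.word_rel[of l r R "a @ u" "v @ b"] by simp
qed (auto intro: word_eq.intros)

lemma word_eq_append2: "word_eq R u u' \<Longrightarrow> word_eq R v v' \<Longrightarrow> word_eq R (u @ v) (u' @ v')"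
  using word_eq_append[of R u u' "[]" v] word_eq_append[of R v v' u' "[]"] by (auto intro: word_trans)

lemma word_class_eq_iff: "word_class R u = word_class R v \<longleftrightarrow> word_eq R u v"
  unfolding word_class_def by (blast intro: word_eq.intros)

lemma presented_group_simps:
  "carrier (presented_group R) = range (word_class R)"
  "word_class R u \<otimes>\<^bsub>presented_group R\<^esub> word_class R v = word_class R (u @ v)"
  "\<one>\<^bsub>presented_group R\<^esub> = word_class R []"
proof -
  show "carrier (presented_group R) = range (word_class R)"
    by (auto simp: presented_group_def word_class_def quotient_def)
  show "word_class R u \<otimes>\<^bsub>presented_group R\<^esub> word_class R v = word_class R (u @ v)"
    by (auto simp: presented_group_def word_class_def intro: word_refl word_trans word_eq_append2)
  show "\<one>\<^bsub>presented_group R\<^esub> = word_class R []"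
    by (simp add: presented_group_def word_class_def)
qed

lemma group_presented_group: "group (presented_group R)"
proof (rule groupI)
  have "\<exists>v. word_eq R (v @ w) []" for w
  proof (induction w)
    case (Cons l w)
    then obtain v where v: "word_eq R (v @ w) []" by blast
    obtain x b where l: "l = (x, b)" by (cases l)
    have "word_eq R ((v @ [(x, \<not> b)]) @ l # w) (v @ w)"
      using word_cancel[of R v x "\<not> b" w] by (simp add: l)
    with v show ?case by (blast intro: word_trans)
  qed (auto intro: word_refl)
  then show "\<exists>B\<in>carrier (presented_group R). B \<otimes>\<^bsub>presented_group R\<^esub> A = \<one>\<^bsub>presented_group R\<^esub>"
    if "A \<in> carrier (presented_group R)" for A
    using that by (auto simp: presented_group_simps word_class_eq_iff)
qed (auto simp: presented_group_simps)

abbreviation presented_gen :: "('g word \<times> 'g word) set \<Rightarrow> 'g \<Rightarrow> 'g word set" where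
  "presented_gen R x \<equiv> word_class R [(x, True)]"

lemma presented_gen_inv:
  "inv\<^bsub>presented_group R\<^esub> presented_gen R x = word_class R [(x, False)]"
  using word_cancel[of R "[]" x False "[]"]
  by (intro group.inv_equality[OF group_presented_group])
    (auto simp: presented_group_simps word_class_eq_iff)

lemma presented_relation:
  assumes "(l, r) \<in> R"
  shows "word_class (positive_relations R) (map (\<lambda>x. (x, True)) l) =
    word_class (positive_relations R) (map (\<lambda>x. (x, True)) r)"
proof -
  have "(map (\<lambda>x. (x, True)) l, map (\<lambda>x. (x, True)) r) \<in> positive_relations R"
    using assms by (force simp: positive_relations_def)
  from word_rel[OF this, of "[]" "[]"] show ?thesis by (simp add: word_class_eq_iff)
qed

text \<open>Left multiplication by a generator permutes a finite set that it maps into itself.\<close>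

lemma presented_group_subset:
  fixes R :: "('g word \<times> 'g word) set"
  defines "P \<equiv> presented_group R"
  assumes N: "finite N" "N \<subseteq> carrier P" "\<one>\<^bsub>P\<^esub> \<in> N"
    and closed: "\<And>x n. n \<in> N \<Longrightarrow> presented_gen R x \<otimes>\<^bsub>P\<^esub> n \<in> N"
  shows "carrier P \<subseteq> N"
proof -
  interpret group P unfolding P_def by (rule group_presented_group)
  have gen: "presented_gen R x \<in> carrier P" for x by (simp add: P_def presented_group_simps)
  have closed_inv: "inv\<^bsub>P\<^esub> presented_gen R x \<otimes>\<^bsub>P\<^esub> n \<in> N" if "n \<in> N" for x n
  proof -
    let ?f = "\<lambda>n. presented_gen R x \<otimes>\<^bsub>P\<^esub> n"
    have "inj_on ?f N" by (rule inj_onI) (metis N(2) Units_eq Units_l_cancel gen subsetD)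
    then have "?f ` N = N" using closed N(1) by (intro endo_inj_surj) auto
    with that obtain m where m: "m \<in> N" "n = ?f m" by blast
    then have "inv\<^bsub>P\<^esub> presented_gen R x \<otimes>\<^bsub>P\<^esub> n = m"
      using N(2) gen by (simp add: inv_solve_left' subset_iff)
    with m show ?thesis by simp
  qed
  have "word_class R w \<in> N" for w
  proof (induction w)
    case Nil
    then show ?case using N(3) by (simp add: P_def presented_group_simps)
  next
    case (Cons l w)
    obtain x b where l: "l = (x, b)" by (cases l)
    have "word_class R (l # w) = word_class R [(x, b)] \<otimes>\<^bsub>P\<^esub> word_class R w"
      by (simp add: P_def presented_group_simps l)
    then show ?case
      using closed[OF Cons.IH, of x] closed_inv[OF Cons.IH, of x]
      by (cases b) (simp_all add: P_def presented_gen_inv)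
  qed
  then show ?thesis by (auto simp: P_def presented_group_simps)
qed

context group
begin

definition eval_word :: "('g \<Rightarrow> 'a) \<Rightarrow> 'g word \<Rightarrow> 'a" where
  "eval_word f w = foldr (\<lambda>(x, b) k. (if b then f x else inv (f x)) \<otimes> k) w \<one>"

lemma eval_word_simps [simp]:
  "eval_word f [] = \<one>" "eval_word f ((x, b) # w) = (if b then f x else inv (f x)) \<otimes> eval_word f w"
  by (simp_all add: eval_word_def)

text \<open>The universal property of the presentation: evaluation of words respects each generating
  step of \<open>word_eq\<close>, so its value on a class may be read off from any
  representative.\<close>

lemma presented_group_hom:
  assumes f: "\<And>x. f x \<in> carrier G"
    and R: "\<And>l r. (l, r) \<in> R \<Longrightarrow> eval_word f l = eval_word f r"
  obtains \<Phi> where "\<Phi> \<in> hom (presented_group R) G" "\<And>x. \<Phi> (presented_gen R x) = f x"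
proof -
  have closed: "eval_word f w \<in> carrier G" for w
    by (induction w) (auto simp: f)
  have append: "eval_word f (u @ v) = eval_word f u \<otimes> eval_word f v" for u v
    by (induction u) (auto simp: f closed m_assoc)
  have eq: "eval_word f u = eval_word f v" if "word_eq R u v" for u v
    using that
  proof (induction rule: word_eq.induct)
    case (word_cancel u x b v)
    show ?case using f closed by (cases b) (simp_all add: append flip: m_assoc)
  qed (simp_all add: append R)
  define \<Phi> where "\<Phi> = (\<lambda>A. eval_word f (SOME w. w \<in> A))"
  have \<Phi>: "\<Phi> (word_class R w) = eval_word f w" for w
    unfolding \<Phi>_def by (rule someI2[of _ w]) (auto simp: word_class_def word_refl eq)
  show thesis
  proof
    show "\<Phi> \<in> hom (presented_group R) G"
      by (rule homI) (auto simp: presented_group_simps \<Phi> closed append)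
    show "\<Phi> (presented_gen R x) = f x" for x by (simp add: \<Phi> f)
  qed
qed

end

subsection \<open>The two polycyclic presentations\<close>

text \<open>
  The presentations of \<open>G1\<close> and \<open>G2\<close>, for \<open>\<tau> = False\<close> and \<open>\<tau> = True\<close>. The word
  \<open>f\<^sub>1\<^sup>a f\<^sub>2\<^sup>b \<dots>\<close> with Boolean exponents is \<open>push f\<^sub>1 a (push f\<^sub>2 b \<dots>)\<close>.
\<close>

definition power_relations :: "bool \<Rightarrow> (gen list \<times> gen list) set" where
  "power_relations \<tau> = {([F1, F1], if \<tau> then [] else [F5]), ([F2, F2], [F6]),
     ([F3, F3], if \<tau> then [F5] else []), ([F4, F4], if \<tau> then [F5] else []), ([F5, F5], []), ([F6, F6], [])}"

locale polycyclic = group P for P (structure) +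
  fixes \<tau> :: bool and f :: "gen \<Rightarrow> 'a"
  assumes f_carrier [simp]: "f x \<in> carrier P"
    and f1: "f F1 \<otimes> f F1 = (if \<tau> then \<one> else f F5)" and f2: "f F2 \<otimes> f F2 = f F6"
    and f3: "f F3 \<otimes> f F3 = (if \<tau> then f F5 else \<one>)" and f4: "f F4 \<otimes> f F4 = (if \<tau> then f F5 else \<one>)"
    and f5: "f F5 \<otimes> f F5 = \<one>" and f6: "f F6 \<otimes> f F6 = \<one>"
    and f21: "f F2 \<otimes> f F1 = f F1 \<otimes> (f F2 \<otimes> f F5)" and f31: "f F3 \<otimes> f F1 = f F1 \<otimes> (f F3 \<otimes> f F6)"
    and f42: "f F4 \<otimes> f F2 = f F2 \<otimes> (f F4 \<otimes> f F5)" and f32: "f F3 \<otimes> f F2 = f F2 \<otimes> f F3"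
    and f41: "f F4 \<otimes> f F1 = f F1 \<otimes> f F4" and f43: "f F4 \<otimes> f F3 = f F3 \<otimes> f F4"
    and f5x: "f F5 \<otimes> f x = f x \<otimes> f F5" and f6x: "f F6 \<otimes> f x = f x \<otimes> f F6"
begin

definition push :: "gen \<Rightarrow> bool \<Rightarrow> 'a \<Rightarrow> 'a" where
  "push x b y = (if b then f x \<otimes> y else y)"

lemma push_closed [simp]: "y \<in> carrier P \<Longrightarrow> push x b y \<in> carrier P"
  by (simp add: push_def)

lemma left_rule:
  assumes "a \<otimes> b = c \<otimes> d" "a \<in> carrier P" "b \<in> carrier P" "c \<in> carrier P" "d \<in> carrier P" "y \<in> carrier P"
  shows "a \<otimes> (b \<otimes> y) = c \<otimes> (d \<otimes> y)"
  using assms by (simp flip: m_assoc)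

text \<open>The collection process as terminating rewrite rules: generators with smaller index move
  left, equal ones merge, and the central tails in f5 and f6 move right. Boolean exponents let one
  rule cover all four cases.\<close>

lemma push_collect:
  assumes y: "y \<in> carrier P"
  shows "push F1 a (push F1 b y) = push F1 (a \<noteq> b) (push F5 (\<not> \<tau> \<and> a \<and> b) y)"
    and "push F2 a (push F2 b y) = push F2 (a \<noteq> b) (push F6 (a \<and> b) y)"
    and "push F3 a (push F3 b y) = push F3 (a \<noteq> b) (push F5 (\<tau> \<and> a \<and> b) y)"
    and "push F4 a (push F4 b y) = push F4 (a \<noteq> b) (push F5 (\<tau> \<and> a \<and> b) y)"
    and "push F5 a (push F5 b y) = push F5 (a \<noteq> b) y"
    and "push F6 a (push F6 b y) = push F6 (a \<noteq> b) y"
    and "push F2 a (push F1 b y) = push F1 b (push F2 a (push F5 (a \<and> b) y))"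
    and "push F3 a (push F1 b y) = push F1 b (push F3 a (push F6 (a \<and> b) y))"
    and "push F4 a (push F1 b y) = push F1 b (push F4 a y)"
    and "push F3 a (push F2 b y) = push F2 b (push F3 a y)"
    and "push F4 a (push F2 b y) = push F2 b (push F4 a (push F5 (a \<and> b) y))"
    and "push F4 a (push F3 b y) = push F3 b (push F4 a y)"
    and "x \<noteq> F5 \<Longrightarrow> x \<noteq> F6 \<Longrightarrow> push F5 a (push x b y) = push x b (push F5 a y)"
    and "x \<noteq> F6 \<Longrightarrow> push F6 a (push x b y) = push x b (push F6 a y)"
proof -
  have sq: "f x \<otimes> (f x \<otimes> y) = z \<otimes> y" if "f x \<otimes> f x = z" for x z
    using y that by (simp flip: m_assoc)
  note left = left_rule[OF _ _ _ _ _ y]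
  show "push F1 a (push F1 b y) = push F1 (a \<noteq> b) (push F5 (\<not> \<tau> \<and> a \<and> b) y)"
    "push F2 a (push F2 b y) = push F2 (a \<noteq> b) (push F6 (a \<and> b) y)"
    "push F3 a (push F3 b y) = push F3 (a \<noteq> b) (push F5 (\<tau> \<and> a \<and> b) y)"
    "push F4 a (push F4 b y) = push F4 (a \<noteq> b) (push F5 (\<tau> \<and> a \<and> b) y)"
    "push F5 a (push F5 b y) = push F5 (a \<noteq> b) y"
    "push F6 a (push F6 b y) = push F6 (a \<noteq> b) y"
    using y by (auto simp: push_def sq[OF f1] sq[OF f2] sq[OF f3] sq[OF f4] sq[OF f5] sq[OF f6])
  show "push F2 a (push F1 b y) = push F1 b (push F2 a (push F5 (a \<and> b) y))"
    "push F3 a (push F1 b y) = push F1 b (push F3 a (push F6 (a \<and> b) y))"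
    "push F4 a (push F1 b y) = push F1 b (push F4 a y)"
    "push F3 a (push F2 b y) = push F2 b (push F3 a y)"
    "push F4 a (push F2 b y) = push F2 b (push F4 a (push F5 (a \<and> b) y))"
    "push F4 a (push F3 b y) = push F3 b (push F4 a y)"
    using y by (simp_all add: push_def left[OF f21] left[OF f31] left[OF f41] left[OF f32] left[OF f42] left[OF f43] m_assoc)
  show "push F5 a (push x b y) = push x b (push F5 a y)" if "x \<noteq> F5" "x \<noteq> F6"
    using y by (simp add: push_def left[OF f5x])
  show "push F6 a (push x b y) = push x b (push F6 a y)" if "x \<noteq> F6"
    using y by (simp add: push_def left[OF f6x])
qed

fun normal :: "bool \<times> bool \<times> bool \<times> bool \<times> bool \<times> bool \<Rightarrow> 'a" where
  "normal (a, b, c, d, e, g) = push F1 a (push F2 b (push F3 c (push F4 d (push F5 e (push F6 g \<one>)))))"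

lemma normal_closed:
  assumes "n \<in> range normal"
  shows "f x \<otimes> n \<in> range normal"
proof -
  obtain a b c d e g where n: "n = normal (a, b, c, d, e, g)"
    using assms by (metis imageE prod_cases6)
  \<comment> \<open>The exponents of the collected word are not written down; the rewritten
    expression has the shape of a normal form and determines them by unification.\<close>
  have "\<exists>m. push x True n = normal m"
    unfolding n normal.simps
    by (cases x; simp only: push_collect push_closed one_closed gen.distinct not_False_eq_True;
        rule exI; rule normal.simps[symmetric])
  moreover have "push x True n = f x \<otimes> n" by (simp add: push_def)
  ultimately show ?thesis by (metis rangeI)
qed

lemma card_normal: "finite (range normal)" "card (range normal) \<le> 64"
  using card_image_le[of "UNIV :: (bool \<times> bool \<times> bool \<times> bool \<times> bool \<times> bool) set" normal]
  by (simp_all add: card_UNIV_bool)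

end

lemma polycyclic_presented_group:
  assumes S: "power_relations \<tau> \<union> commutation_relations \<subseteq> S"
  shows "polycyclic (presented_group (positive_relations S)) \<tau> (presented_gen (positive_relations S))"
proof -
  have rel: "word_class (positive_relations S) (map (\<lambda>x. (x, True)) l) =
      word_class (positive_relations S) (map (\<lambda>x. (x, True)) r)"
    if "(l, r) \<in> power_relations \<tau> \<or> (l, r) \<in> commutation_relations" for l r
    using that S by (intro presented_relation) blast
  let ?P = "presented_group (positive_relations S)" and ?f = "presented_gen (positive_relations S)"
  note power = rel[OF disjI1, unfolded power_relations_def] and comm = rel[OF disjI2, unfolded commutation_relations_def]
  show ?thesis
  proof (intro polycyclic.intro polycyclic_axioms.intro group_presented_group)
    show "?f x \<in> carrier ?P" for x by (simp add: presented_group_simps)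
    show "?f F1 \<otimes>\<^bsub>?P\<^esub> ?f F1 = (if \<tau> then \<one>\<^bsub>?P\<^esub> else ?f F5)"
      using power[of "[F1, F1]" "if \<tau> then [] else [F5]"] by (simp add: presented_group_simps split: if_splits)
    show "?f F2 \<otimes>\<^bsub>?P\<^esub> ?f F2 = ?f F6"
      using power[of "[F2, F2]" "[F6]"] by (simp add: presented_group_simps)
    show "?f F3 \<otimes>\<^bsub>?P\<^esub> ?f F3 = (if \<tau> then ?f F5 else \<one>\<^bsub>?P\<^esub>)"
      using power[of "[F3, F3]" "if \<tau> then [F5] else []"] by (simp add: presented_group_simps split: if_splits)
    show "?f F4 \<otimes>\<^bsub>?P\<^esub> ?f F4 = (if \<tau> then ?f F5 else \<one>\<^bsub>?P\<^esub>)"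
      using power[of "[F4, F4]" "if \<tau> then [F5] else []"] by (simp add: presented_group_simps split: if_splits)
    show "?f F5 \<otimes>\<^bsub>?P\<^esub> ?f F5 = \<one>\<^bsub>?P\<^esub>" "?f F6 \<otimes>\<^bsub>?P\<^esub> ?f F6 = \<one>\<^bsub>?P\<^esub>"
      using power[of "[F5, F5]" "[]"] power[of "[F6, F6]" "[]"] by (simp_all add: presented_group_simps)
    show "?f F2 \<otimes>\<^bsub>?P\<^esub> ?f F1 = ?f F1 \<otimes>\<^bsub>?P\<^esub> (?f F2 \<otimes>\<^bsub>?P\<^esub> ?f F5)"
      using comm[of "[F2, F1]" "[F1, F2, F5]"] by (simp add: presented_group_simps)
    show "?f F3 \<otimes>\<^bsub>?P\<^esub> ?f F1 = ?f F1 \<otimes>\<^bsub>?P\<^esub> (?f F3 \<otimes>\<^bsub>?P\<^esub> ?f F6)"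
      using comm[of "[F3, F1]" "[F1, F3, F6]"] by (simp add: presented_group_simps)
    show "?f F4 \<otimes>\<^bsub>?P\<^esub> ?f F2 = ?f F2 \<otimes>\<^bsub>?P\<^esub> (?f F4 \<otimes>\<^bsub>?P\<^esub> ?f F5)"
      using comm[of "[F4, F2]" "[F2, F4, F5]"] by (simp add: presented_group_simps)
    show "?f F3 \<otimes>\<^bsub>?P\<^esub> ?f F2 = ?f F2 \<otimes>\<^bsub>?P\<^esub> ?f F3"
      using comm[of "[F3, F2]" "[F2, F3]"] by (simp add: presented_group_simps)
    show "?f F4 \<otimes>\<^bsub>?P\<^esub> ?f F1 = ?f F1 \<otimes>\<^bsub>?P\<^esub> ?f F4"
      using comm[of "[F4, F1]" "[F1, F4]"] by (simp add: presented_group_simps)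
    show "?f F4 \<otimes>\<^bsub>?P\<^esub> ?f F3 = ?f F3 \<otimes>\<^bsub>?P\<^esub> ?f F4"
      using comm[of "[F4, F3]" "[F3, F4]"] by (simp add: presented_group_simps)
    show "?f F5 \<otimes>\<^bsub>?P\<^esub> ?f x = ?f x \<otimes>\<^bsub>?P\<^esub> ?f F5" for x
      using comm[of "[F5, x]" "[x, F5]"] by (simp add: presented_group_simps)
    show "?f F6 \<otimes>\<^bsub>?P\<^esub> ?f x = ?f x \<otimes>\<^bsub>?P\<^esub> ?f F6" for x
      using comm[of "[F6, x]" "[x, F6]"] by (simp add: presented_group_simps)
  qed
qed

lemma G1_G2_alt:
  "G1 = presented_group (positive_relations (power_relations False \<union> commutation_relations))"
  "G2 = presented_group (positive_relations (power_relations True \<union> commutation_relations))"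
  by (simp_all add: G1_def G2_def power_relations_def)

section \<open>The model group and coordinates on the presented groups\<close>

definition ik_group :: "bool \<Rightarrow> coord monoid" where
  "ik_group \<epsilon> = \<lparr>carrier = UNIV, monoid.mult = ik_mult \<epsilon>, one = (0, 0, False, False)\<rparr>"

lemma ik_group_simps [simp]:
  "carrier (ik_group \<epsilon>) = UNIV" "x \<otimes>\<^bsub>ik_group \<epsilon>\<^esub> y = ik_mult \<epsilon> x y"
  "\<one>\<^bsub>ik_group \<epsilon>\<^esub> = (0, 0, False, False)"
  by (simp_all add: ik_group_def)

text \<open>The terms governed by \<epsilon> are bilinear in the bits and take values in 2A, where
  the matrices act trivially. They thus form a 2-cocycle, which is what associativity
  requires.\<close>

lemma group_ik_group: "group (ik_group \<epsilon>)"
proof (rule groupI)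
  fix x y z :: coord
  obtain a b p q where x: "x = (a, b, p, q)" by (metis prod_cases4)
  obtain a' b' p' q' where y: "y = (a', b', p', q')" by (metis prod_cases4)
  obtain a'' b'' p'' q'' where z: "z = (a'', b'', p'', q'')" by (metis prod_cases4)
  show "x \<otimes>\<^bsub>ik_group \<epsilon>\<^esub> y \<otimes>\<^bsub>ik_group \<epsilon>\<^esub> z = x \<otimes>\<^bsub>ik_group \<epsilon>\<^esub> (y \<otimes>\<^bsub>ik_group \<epsilon>\<^esub> z)"
    by (cases \<epsilon>; cases p; cases q; cases p'; cases q'; cases p''; cases q'')
      (simp_all add: x y z four_numerals distrib_left add_ac)
  \<comment> \<open>In the product with this left inverse each correction term appears twice, with
    coefficient 2, and so vanishes.\<close>
  have "ik_mult \<epsilon> (- a + 2 * of_bool p * b + 2 * of_bool (\<epsilon> \<and> p), - b + 2 * of_bool q * a + 2 * of_bool (\<epsilon> \<and> q), p, q) x =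
      (0, 0, False, False)"
    by (cases \<epsilon>; cases p; cases q) (simp_all add: x four_numerals distrib_left add_ac)
  then show "\<exists>w\<in>carrier (ik_group \<epsilon>). w \<otimes>\<^bsub>ik_group \<epsilon>\<^esub> x = \<one>\<^bsub>ik_group \<epsilon>\<^esub>"
    by auto
qed (simp_all add: ik_mult_one)

text \<open>f2 is a basis translation, f4 is h2, f1 is (0, 1) times h2, and f5, f6 are the doubled
  basis translations. For \<tau> true the lift of h1 squares to (2, 0), which is f6, whereas f3 must
  square to f5; multiplying it by the translation (0, 1) changes the square to (0, 2).\<close>

fun ik_gen :: "bool \<Rightarrow> gen \<Rightarrow> coord" where
  "ik_gen \<tau> F1 = (0, 1, False, True)"
| "ik_gen \<tau> F2 = (1, 0, False, False)"
| "ik_gen \<tau> F3 = (0, of_bool \<tau>, True, False)"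
| "ik_gen \<tau> F4 = (0, 0, False, True)"
| "ik_gen \<tau> F5 = (0, 2, False, False)"
| "ik_gen \<tau> F6 = (2, 0, False, False)"

lemma ik_gen_generate:
  assumes gen: "\<And>x. ik_gen \<tau> x \<in> I" and mult: "\<And>x y. x \<in> I \<Longrightarrow> y \<in> I \<Longrightarrow> ik_mult \<tau> x y \<in> I"
  shows "I = UNIV"
proof -
  note m = mult[where x = "(_, _, _, _)" and y = "(_, _, _, _)", simplified]
  have 1: "(1, 0, False, False) \<in> I" and 2: "(2, 0, False, False) \<in> I" and 3: "(0, 2, False, False) \<in> I"
    using gen[of F2] gen[of F6] gen[of F5] by simp_all
  have q: "(0, 0, False, True) \<in> I" using gen[of F4] by simp
  \<comment> \<open>The product of f1 and f4 cancels the matrix part; the remaining 2 is the square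
    of the lift of h2 when \<tau> is true.\<close>
  have 4: "(0, 1 + 2 * of_bool \<tau>, False, False) \<in> I"
    using mult[OF gen[of F1] gen[of F4]] by simp
  have 5: "(0, 1, False, False) \<in> I"
    using 4 mult[OF 4 3] by (cases \<tau>) (simp_all add: four_numerals)
  have a: "(a, 0, False, False) \<in> I" for a
    using 1 2 mult[OF 1 2] mult[OF 2 2] four_cases[of a] by (auto simp: four_numerals)
  have b: "(0, b, False, False) \<in> I" for b
    using 5 3 mult[OF 5 3] mult[OF 3 3] four_cases[of b] by (auto simp: four_numerals)
  \<comment> \<open>Removes the translation that the image of f3 carries when \<tau> is
    true.\<close>
  have p: "(0, 0, True, False) \<in> I"
    using mult[OF b[of "- of_bool \<tau>"] gen[of F3]] by (cases \<tau>) simp_all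
  have "(a, b, p, q) \<in> I" for a b p q
  proof -
    have "ik_mult \<tau> (a, 0, False, False) (0, b, False, False) = (a, b, False, False)"
      "ik_mult \<tau> (a, b, False, False) (0, 0, True, False) = (a, b, True, False)"
      "ik_mult \<tau> (a, b, False, False) (0, 0, False, True) = (a, b, False, True)"
      "ik_mult \<tau> (a, b, True, False) (0, 0, False, True) = (a, b, True, True)" by simp_all
    then show ?thesis using a b \<open>(0, 0, True, False) \<in> I\<close> \<open>(0, 0, False, True) \<in> I\<close> mult
      by (cases p; cases q) metis+
  qed
  then show ?thesis by auto
qed

text \<open>Collection bounds the order of the presented group by 64 from above, and a surjection
  onto the model bounds it from below. Hence the surjection is bijective, and uniqueness of normal
  forms comes out without a confluence check.\<close>

lemma ik_coords_presented_group:
  assumes S: "S = power_relations \<tau> \<union> commutation_relations"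
  shows "\<exists>c. ik_coords (presented_group (positive_relations S)) \<tau> c"
proof -
  let ?P = "presented_group (positive_relations S)"
  interpret I: group "ik_group \<tau>" by (rule group_ik_group)
  interpret P: polycyclic ?P \<tau> "presented_gen (positive_relations S)"
    by (rule polycyclic_presented_group) (simp add: S)
  have eval: "I.eval_word (ik_gen \<tau>) (map (\<lambda>x. (x, True)) w) = foldr (ik_mult \<tau>) (map (ik_gen \<tau>) w) (0, 0, False, False)" for w
    by (induction w) simp_all
  have "I.eval_word (ik_gen \<tau>) (map (\<lambda>x. (x, True)) l) = I.eval_word (ik_gen \<tau>) (map (\<lambda>x. (x, True)) r)" if "(l, r) \<in> S" for l r
  proof -
    have "ik_mult \<tau> (ik_gen \<tau> F5) (ik_gen \<tau> x) = ik_mult \<tau> (ik_gen \<tau> x) (ik_gen \<tau> F5)"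
      "ik_mult \<tau> (ik_gen \<tau> F6) (ik_gen \<tau> x) = ik_mult \<tau> (ik_gen \<tau> x) (ik_gen \<tau> F6)" for x
      by (cases x; simp add: four_numerals add_ac)+
    moreover have "foldr (ik_mult \<tau>) (map (ik_gen \<tau>) l) (0, 0, False, False) =
        foldr (ik_mult \<tau>) (map (ik_gen \<tau>) r) (0, 0, False, False)" if "(l, r) \<in> power_relations \<tau>"
      using that unfolding power_relations_def by (cases \<tau>) (auto simp: four_numerals)
    ultimately show ?thesis
      unfolding eval using that unfolding S commutation_relations_def
      by (auto simp: ik_mult_one four_numerals simp del: ik_mult.simps) (simp_all add: four_numerals)
  qed
  then have rels: "I.eval_word (ik_gen \<tau>) l = I.eval_word (ik_gen \<tau>) r" if "(l, r) \<in> positive_relations S" for l r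
    using that by (auto simp: positive_relations_def)
  obtain c where c: "c \<in> hom ?P (ik_group \<tau>)" "\<And>x. c (presented_gen (positive_relations S) x) = ik_gen \<tau> x"
    by (rule I.presented_group_hom[OF _ rels]) auto
  have mult: "c (x \<otimes>\<^bsub>?P\<^esub> y) = ik_mult \<tau> (c x) (c y)" if "x \<in> carrier ?P" "y \<in> carrier ?P" for x y
    using hom_mult[OF c(1) that] by simp
  have "carrier ?P \<subseteq> range P.normal"
  proof (rule presented_group_subset)
    have "P.normal (False, False, False, False, False, False) = \<one>\<^bsub>?P\<^esub>" by (simp add: P.push_def)
    then show "\<one>\<^bsub>?P\<^esub> \<in> range P.normal" by (metis rangeI)
    show "range P.normal \<subseteq> carrier ?P" by (auto simp del: presented_group_simps)
    show "finite (range P.normal)" by (rule P.card_normal)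
    show "presented_gen (positive_relations S) x \<otimes>\<^bsub>?P\<^esub> n \<in> range P.normal" if "n \<in> range P.normal" for x n
      using that by (rule P.normal_closed)
  qed
  then have fin: "finite (carrier ?P)" and card: "card (carrier ?P) \<le> 64"
    using finite_subset[OF _ P.card_normal(1)] le_trans[OF card_mono[OF P.card_normal(1)] P.card_normal(2)] by blast+
  have surj: "c ` carrier ?P = UNIV"
  proof (rule ik_gen_generate[where \<tau> = \<tau>])
    show "ik_gen \<tau> x \<in> c ` carrier ?P" for x using c(2)[of x] P.f_carrier by (metis imageI)
    show "ik_mult \<tau> x y \<in> c ` carrier ?P" if "x \<in> c ` carrier ?P" "y \<in> c ` carrier ?P" for x y
      using that by (auto simp flip: mult)
  qed
  have "card (c ` carrier ?P) = card (carrier ?P)"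
    using card card_image_le[OF fin, of c] by (simp add: surj)
  then have "bij_betw c (carrier ?P) UNIV"
    using fin surj by (simp add: bij_betw_def eq_card_imp_inj_on)
  then show ?thesis
    using mult by (intro exI[of _ c] ik_coords.intro ik_coords_axioms.intro) (auto intro: P.is_group)
qed

subsection \<open>Orders of elements\<close>

text \<open>Turns counting into an iterated sum over the coordinates, which simplification can
  evaluate.\<close>

lemma card_coord: "card {x :: coord. P x} =
    (\<Sum>a\<in>UNIV. \<Sum>b\<in>UNIV. \<Sum>p\<in>UNIV. \<Sum>q\<in>UNIV. of_bool (P (a, b, p, q)))"
proof -
  have "card {x :: coord. P x} = (\<Sum>x\<in>UNIV. of_bool (P x))" by simp
  also have "\<dots> = (\<Sum>a\<in>UNIV. \<Sum>b\<in>UNIV. \<Sum>p\<in>UNIV. \<Sum>q\<in>UNIV. of_bool (P (a, b, p, q)))"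
    by (simp add: sum.cartesian_product case_prod_beta' del: sum_of_bool_eq)
  finally show ?thesis .
qed

lemma sum_four: "(\<Sum>x\<in>UNIV. f x) = f 0 + f 1 + f 2 + f (3::4)"
  unfolding four_UNIV by (simp add: add.assoc)

text \<open>The solutions number 4, 4, 4 and 8 in the cosets of 1, h1, h2 and h1 h2, for both values
  of \<epsilon>: the twist changes the parity conditions on a and b but not the number of their
  solutions.\<close>

lemma card_involutions: "card {x. ik_mult \<epsilon> x x = (0, 0, False, False)} = 20"
  unfolding card_coord sum_four UNIV_bool by (cases \<epsilon>) simp_all

lemma divisors_64: "sorted_list_of_set {d::nat. d dvd 64} = [1, 2, 4, 8, 16, 32, 64]"
proof -
  have "{d::nat. d dvd 2 ^ 6} = (\<lambda>i. 2 ^ i) ` {..6}"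
    using divides_primepow_nat[OF two_is_prime_nat, of _ 6] by auto
  also have "\<dots> = set [1, 2, 4, 8, 16, 32, 64]"
  proof -
    have "{..6::nat} = {0, 1, 2, 3, 4, 5, 6}" by auto
    then show ?thesis by simp
  qed
  finally have "{d::nat. d dvd 64} = set [1, 2, 4, 8, 16, 32, 64]" by simp
  then show ?thesis by (simp add: sorted_list_of_set_sort_remdups)
qed

context ik_coords
begin

lemma order_eq: "Coset.order G = 64"
  using bij_betw_same_card[OF c_bij] by (simp add: Coset.order_def)

lemma ord_eq:
  assumes x: "x \<in> carrier G"
  shows "ord x = (if x = \<one> then 1 else if x \<otimes> x = \<one> then 2 else 4)"
proof -
  \<comment> \<open>A square has trivial matrix part and even translation part, so its own square is
    trivial.\<close>
  have 4: "(x \<otimes> x) \<otimes> (x \<otimes> x) = \<one>"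
  proof -
    have "ik_mult \<epsilon> (ik_mult \<epsilon> y y) (ik_mult \<epsilon> y y) = (0, 0, False, False)" for y
      by (cases y) (simp add: four_numerals distrib_left add_ac)
    then show ?thesis using x c_eq_iff[of "(x \<otimes> x) \<otimes> (x \<otimes> x)" \<one>] by (simp add: c_mult c_one)
  qed
  have pow: "x [^] (2::nat) = x \<otimes> x" "x [^] (4::nat) = (x \<otimes> x) \<otimes> (x \<otimes> x)"
    using x by (simp_all add: numeral_eq_Suc m_assoc)
  have "ord x dvd 2 ^ 2" using 4 x by (simp add: pow flip: pow_eq_id)
  then obtain i where i: "i \<le> 2" "ord x = 2 ^ i"
    using divides_primepow_nat[OF two_is_prime_nat] by blast
  have "ord x dvd 2 \<longleftrightarrow> x \<otimes> x = \<one>" using x by (simp add: pow flip: pow_eq_id)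
  moreover have "ord x = 1 \<longleftrightarrow> x = \<one>" using x pow_eq_id[OF x, of 1] by simp
  moreover have "i = 0 \<or> i = 1 \<or> i = 2" using i by auto
  ultimately show ?thesis using i by auto
qed

lemma order_list_eq: "order_list G = [1, 19, 44, 0, 0, 0, 0]"
proof -
  let ?I = "{x \<in> carrier G. x \<otimes> x = \<one>}"
  have fin: "finite (carrier G)" using order_eq by (simp add: Coset.order_def card_ge_0_finite)
  have "bij_betw c ?I {x. ik_mult \<epsilon> x x = (0, 0, False, False)}"
  proof (rule bij_betw_subset[OF c_bij])
    have "x \<otimes> x = \<one> \<longleftrightarrow> ik_mult \<epsilon> (c x) (c x) = (0, 0, False, False)" if "x \<in> carrier G" for x
      using that c_eq_iff[of "x \<otimes> x" \<one>] by (simp add: c_mult c_one)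
    then have "c ` ?I = {y \<in> c ` carrier G. ik_mult \<epsilon> y y = (0, 0, False, False)}" by blast
    then show "c ` ?I = {x. ik_mult \<epsilon> x x = (0, 0, False, False)}"
      unfolding bij_betw_imp_surj_on[OF c_bij] by simp
  qed auto
  then have I: "card ?I = 20" using card_involutions bij_betw_same_card by fastforce
  have 1: "{x \<in> carrier G. ord x = 1} = {\<one>}" and 2: "{x \<in> carrier G. ord x = 2} = ?I - {\<one>}"
    and 4: "{x \<in> carrier G. ord x = 4} = carrier G - ?I"
    and 0: "d \<notin> {1, 2, 4} \<Longrightarrow> {x \<in> carrier G. ord x = d} = {}" for d
    using ord_eq by (auto split: if_splits)
  have "card {x \<in> carrier G. ord x = 2} = 19" unfolding 2 using I by simp
  moreover have "card {x \<in> carrier G. ord x = 4} = 44"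
    unfolding 4 using I order_eq fin by (subst card_Diff_subset) (auto simp: Coset.order_def intro: finite_subset)
  moreover have "card {x \<in> carrier G. ord x = 8} = 0" "card {x \<in> carrier G. ord x = 16} = 0"
    "card {x \<in> carrier G. ord x = 32} = 0" "card {x \<in> carrier G. ord x = 64} = 0"
    by (subst 0; simp)+
  ultimately show ?thesis
    unfolding order_list_def order_eq divisors_64 using 1 by simp
qed

lemma commute_iff:
  "x \<in> carrier G \<Longrightarrow> y \<in> carrier G \<Longrightarrow> x \<otimes> y = y \<otimes> x \<longleftrightarrow> ik_mult \<epsilon> (c x) (c y) = ik_mult \<epsilon> (c y) (c x)"
  using c_eq_iff[of "x \<otimes> y" "y \<otimes> x"] by (simp add: c_mult)

end

subsection \<open>The groups are not isomorphic\<close>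

text \<open>
  In the untwisted group the centralizer of \<open>h\<^sub>1\<close> has index 2; in the twisted group every noncentral
  involution has a centralizer of index 4.
\<close>

lemma ik_coords_incompatible:
  assumes "ik_coords G False c" "ik_coords G True d"
  shows False
proof -
  interpret C: ik_coords G False c by fact
  interpret D: ik_coords G True d by fact
  \<comment> \<open>The involution h1 of the untwisted coordinates. Its image under d is unknown, so
    only properties independent of the coordinates can be carried over.\<close>
  define x where "x = C.elt (0, 0, True, False)"
  have x: "x \<in> carrier G" "c x = (0, 0, True, False)" by (simp_all add: x_def C.elt)
  have comm: "x \<otimes>\<^bsub>G\<^esub> y = y \<otimes>\<^bsub>G\<^esub> x \<longleftrightarrow> 2 * fst (snd (c y)) = 0" if "y \<in> carrier G" for y
    using C.commute_iff[OF x(1) that] by (cases "c y") (auto simp: x(2))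
  \<comment> \<open>Index at most 2 without counting cosets: two elements outside the centralizer
    have their product in it. Here being outside means that the second coordinate is odd, and the
    sum of two odd numbers is even.\<close>
  have index2: "x \<otimes>\<^bsub>G\<^esub> (y \<otimes>\<^bsub>G\<^esub> z) = (y \<otimes>\<^bsub>G\<^esub> z) \<otimes>\<^bsub>G\<^esub> x"
    if "y \<in> carrier G" "z \<in> carrier G" "x \<otimes>\<^bsub>G\<^esub> y \<noteq> y \<otimes>\<^bsub>G\<^esub> x" "x \<otimes>\<^bsub>G\<^esub> z \<noteq> z \<otimes>\<^bsub>G\<^esub> x" for y z
  proof -
    obtain a b p q where y: "c y = (a, b, p, q)" by (metis prod_cases4)
    obtain a' b' p' q' where z: "c z = (a', b', p', q')" by (metis prod_cases4)
    have "2 * b \<noteq> 0" "2 * b' \<noteq> 0" using that by (simp_all add: comm y z)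
    then have "2 * (b + b') = 0"
      using four_cases[of b] four_cases[of b'] by (elim disjE) (simp_all add: four_numerals)
    then show ?thesis
      using that by (subst comm) (simp_all add: C.c_mult y z distrib_left add_ac four_numerals)
  qed
  have index2': "ik_mult True (d x) v = ik_mult True v (d x) \<or> ik_mult True (d x) w = ik_mult True w (d x) \<or>
      ik_mult True (d x) (ik_mult True v w) = ik_mult True (ik_mult True v w) (d x)" for v w
    using index2[of "D.elt v" "D.elt w"] by (auto simp: D.commute_iff x D.elt D.c_mult)
  have "C.elt (0, 1, False, False) \<in> carrier G \<and>
      x \<otimes>\<^bsub>G\<^esub> C.elt (0, 1, False, False) \<noteq> C.elt (0, 1, False, False) \<otimes>\<^bsub>G\<^esub> x"
    by (simp add: comm C.elt)
  then obtain u where u: "ik_mult True (d x) u \<noteq> ik_mult True u (d x)"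
    using D.commute_iff[OF x(1)] by blast
  have "x \<otimes>\<^bsub>G\<^esub> x = \<one>\<^bsub>G\<^esub>"
    using C.c_eq_iff[of "x \<otimes>\<^bsub>G\<^esub> x" "\<one>\<^bsub>G\<^esub>"] x by (simp add: C.c_mult C.c_one)
  then have inv: "ik_mult True (d x) (d x) = (0, 0, False, False)"
    using D.c_mult[OF x(1) x(1)] by (simp add: D.c_one)
  obtain a b p q where dx: "d x = (a, b, p, q)" by (metis prod_cases4)
  note cases = four_cases[of a] four_cases[of b]
  \<comment> \<open>If both bits vanish, the involution lies in 2A and is central, contradicting u.
    Otherwise the two witnesses v and w have commutators (2, 0) and (0, 2) with it in some order, so
    v, w and their product all fail to commute with it. When a single bit is set, being an
    involution forces a (for p) or b (for q) to be odd, which makes the matrix witness work.\<close>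
  consider "\<not> p" "\<not> q" | "p" "\<not> q" | "\<not> p" "q" | "p" "q" by blast
  then show False
  proof cases
    case 1
    then show ?thesis using inv u by (cases u) (auto simp: dx add_ac of_bool_def split: if_splits)
  next
    case 2
    then show ?thesis
      using inv cases index2'[of "(0, 1, False, False)" "(0, 0, False, True)"] unfolding dx
      by (elim disjE) (simp_all add: four_numerals)
  next
    case 3
    then show ?thesis
      using inv cases index2'[of "(1, 0, False, False)" "(0, 0, True, False)"] unfolding dx
      by (elim disjE) (simp_all add: four_numerals)
  next
    case 4
    then show ?thesis
      using inv cases index2'[of "(0, 1, False, False)" "(1, 0, False, False)"] unfolding dx
      by (elim disjE) (simp_all add: four_numerals)
  qed
qed

lemma (in ik_coords) ik_coords_iso:
  assumes "group H" "h \<in> iso H G"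
  shows "ik_coords H \<epsilon> (\<lambda>x. c (h x))"
proof -
  have bij: "bij_betw h (carrier H) (carrier G)" and hom: "h \<in> hom H G" using assms(2) by (auto simp: iso_def)
  show ?thesis
  proof (intro ik_coords.intro ik_coords_axioms.intro assms(1))
    show "bij_betw (\<lambda>x. c (h x)) (carrier H) UNIV"
      using bij_betw_trans[OF bij c_bij] by (simp add: comp_def)
    show "c (h (x \<otimes>\<^bsub>H\<^esub> y)) = ik_mult \<epsilon> (c (h x)) (c (h y))" if "x \<in> carrier H" "y \<in> carrier H" for x y
      using that hom hom_in_carrier[OF hom] by (simp add: hom_mult c_mult)
  qed
qed

subsection \<open>Coordinates on the Izumi--Kosaki group\<close>

definition ik_vec :: "4 \<Rightarrow> 4 \<Rightarrow> 4 vec" where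
  "ik_vec a b = vec 2 (\<lambda>i. if i = 0 then a else b)"

text \<open>The product of the powers of h1 and h2 in closed form: off-diagonal entries are even, so
  their products vanish modulo 4 and the entries add.\<close>

definition ik_mat :: "bool \<Rightarrow> bool \<Rightarrow> 4 mat" where
  "ik_mat p q = mat 2 2 (\<lambda>(i, j). if i = j then 1 else if i = 0 then 2 * of_bool p else 2 * of_bool q)"

lemma less_two: "(i::nat) < 2 \<longleftrightarrow> i = 0 \<or> i = 1"
  by auto

lemma sum_less_two: "(\<Sum>i = 0..<2. f i) = f 0 + f (1::nat)"
  by (simp add: numeral_2_eq_2)

lemma ik_mat_mult: "ik_mat p q * ik_mat r s = ik_mat (p \<noteq> r) (q \<noteq> s)"
  by (rule eq_matI)
    (auto simp: ik_mat_def less_two scalar_prod_def sum_less_two four_numerals)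

lemma ik_mat_mult_vec: "ik_mat p q *\<^sub>v ik_vec a b = ik_vec (a + 2 * of_bool p * b) (b + 2 * of_bool q * a)"
  by (rule eq_vecI) (auto simp: ik_mat_def ik_vec_def less_two scalar_prod_def sum_less_two)

lemma ik_mat_eqs: "1\<^sub>m 2 = ik_mat False False" "ik_h1 = ik_mat True False" "ik_h2 = ik_mat False True"
  by (auto intro!: eq_matI simp: ik_mat_def ik_h1_def ik_h2_def mat_of_rows_list_def less_two)

lemma G_IK_carrier: "carrier G_IK = range (\<lambda>(a, b, p, q). (ik_vec a b, ik_mat p q))"
proof -
  have "v \<in> range (\<lambda>(a, b). ik_vec a b)" if "v \<in> carrier_vec 2" for v
  proof -
    have "v = ik_vec (v $ 0) (v $ 1)" using that by (auto intro!: eq_vecI simp: ik_vec_def less_two)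
    then show ?thesis by (intro range_eqI[of _ _ "(v $ 0, v $ 1)"]) simp
  qed
  then have "carrier_vec 2 = range (\<lambda>(a, b). ik_vec a b)" by (auto simp: ik_vec_def)
  moreover have "{1\<^sub>m 2, ik_h1, ik_h2, ik_h1 * ik_h2} = range (\<lambda>(p, q). ik_mat p q)"
    by (auto simp: ik_mat_eqs ik_mat_mult image_def) (metis (full_types))
  moreover have "range (\<lambda>(a, b). ik_vec a b) \<times> range (\<lambda>(p, q). ik_mat p q) =
      range (\<lambda>(a, b, p, q). (ik_vec a b, ik_mat p q))" by (auto simp: image_def)
  ultimately show ?thesis by (simp add: G_IK_def affine_semidirect_def)
qed

lemma (in ik_coords) iso_G_IK:
  assumes "\<not> \<epsilon>"
  shows "G \<cong> G_IK"
proof -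
  let ?f = "\<lambda>(a, b, p, q). (ik_vec a b, ik_mat p q)"
  have mult: "?f (ik_mult \<epsilon> x y) = ?f x \<otimes>\<^bsub>G_IK\<^esub> ?f y" for x y
  proof -
    have "ik_vec a b + ik_vec a' b' = ik_vec (a + a') (b + b')" for a b a' b'
      by (rule eq_vecI) (auto simp: ik_vec_def)
    with assms show ?thesis
      by (cases x; cases y) (simp add: G_IK_def affine_semidirect_def ik_mat_mult ik_mat_mult_vec add.assoc)
  qed
  have "inj ?f"
  proof (rule injI)
    fix x y assume eq: "?f x = ?f y"
    have vec: "ik_vec a b $ 0 = a" "ik_vec a b $ 1 = b" for a b by (simp_all add: ik_vec_def)
    have mat: "ik_mat p q $$ (0, 1) = 2 * of_bool p" "ik_mat p q $$ (1, 0) = 2 * of_bool q" for p q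
      by (simp_all add: ik_mat_def)
    have two: "(2 * of_bool p :: 4) = 2 * of_bool q \<longleftrightarrow> p = q" for p q by (cases p; cases q) simp_all
    show "x = y" using eq vec mat two by (cases x; cases y) (simp, metis)
  qed
  then have "bij_betw (\<lambda>x. ?f (c x)) (carrier G) (carrier G_IK)"
    using bij_betw_trans[OF c_bij, of ?f "carrier G_IK"] by (simp add: bij_betw_def G_IK_carrier comp_def)
  moreover from this have "(\<lambda>x. ?f (c x)) \<in> hom G G_IK"
    by (intro homI) (auto simp: bij_betw_def c_mult mult)
  ultimately show ?thesis by (auto simp: is_iso_def iso_def)
qed

theorem theorem6p2:
  shows "group G1 \<and> Coset.order G1 = 64 \<and> group G2 \<and> Coset.order G2 = 64 \<and>
    \<not> G1 \<cong> G2 \<and> monoidally_equivalent G1 G2 \<and>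
    order_list G1 = [1, 19, 44, 0, 0, 0, 0] \<and>
    order_list G2 = [1, 19, 44, 0, 0, 0, 0] \<and>
    G1 \<cong> G_IK"
proof -
  obtain c d where c: "ik_coords G1 False c" and d: "ik_coords G2 True d"
    using ik_coords_presented_group[OF refl] unfolding G1_G2_alt by blast
  interpret C: ik_coords G1 False c by fact
  interpret D: ik_coords G2 True d by fact
  \<comment> \<open>An isomorphism would pull the twisted coordinates of \<open>G2\<close> back to
    \<open>G1\<close>, which already has untwisted ones.\<close>
  have "\<not> G1 \<cong> G2"
    using ik_coords_incompatible[OF c] D.ik_coords_iso[OF C.is_group] by (auto simp: is_iso_def)
  moreover have "monoidally_equivalent G1 G2"
    by (rule ik_coords_monoidally_equivalent[OF c, where d = d]) (simp add: d)
  ultimately show ?thesis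
    using C.is_group D.is_group C.order_eq D.order_eq C.order_list_eq D.order_list_eq C.iso_G_IK by simp
qed

end
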